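(* Let $V=\{0\}$ and let $\Gamma$ be a subgroup of $G$ of type (O) such that $\Gamma\smallsetminus\Gamma_\infty$ is of type (F). Suppose that $\mathcal F_\infty$ is a convex fundamental domain for $\Gamma_\infty$ in $D$ satisfying $$\overline{\mathcal F_\infty}\cap\bigcap_{g\in\Gamma\smallsetminus\Gamma_\infty}\overline{\mathrm{Ext}\, I(g)}=\overline{\mathcal F_\infty\cap\bigcap_{g\in\Gamma\smallsetminus\Gamma_\infty}\mathrm{Ext}\, I(g)}.$$ Then $$\mathcal F:=\mathcal F_\infty\cap\bigcap_{g\in\Gamma\smallsetminus\Gamma_\infty}\mathrm{Ext}\, I(g)$$ is a convex fundamental domain for $\Gamma$ in $D$.
   Context: **The space $D$ for $V=\{0\}$.** This is the case $V=\{0\}$ of a general construction attached to a $J^2C$-module structure $(C,V,J)$; for $V=\{0\}$ the data reduce to the following. $C$ is a finite-dimensional real inner product space with a fixed unit vector $e$, and $C\neq\mathbb Re$. Identify $\mathbb Re$ with $\mathbb R$, put $C'=e^\perp$, and for $\zeta=a+z$ with $a\in\mathbb R$, $z\in C'$ put $\mathrm{Re}\,\zeta=a$, $\mathrm{Im}\,\zeta=z$, $\overline\zeta=a-z$, $\zeta^{-1}=|\zeta|^{-2}\overline\zeta$ (if $\zeta\neq0$). Let $S=\mathbb R^+\times C'$ be the Lie group with product $(t_1,Z_1)(t_2,Z_2)=(t_1t_2,Z_1+t_1Z_2)$ and the left-invariant Riemannian metric which at $(1,0)$ is the standard inner product of $\mathbb R\oplus C'$. Let $D=\{\zeta\in C\mid\mathrm{Re}\,\zeta>0\}$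 with the Riemannian metric making $S\to D$, $(t,Z)\mapsto t+Z$ an isometry (so $D$ is a rank one Riemannian symmetric space of noncompact type). $G$ is the full group of Riemannian isometries of $D$; its action extends continuously to $\overline D^g=\{\zeta\in C\mid\mathrm{Re}\,\zeta\ge0\}\cup\{\infty\}$, the closure of $D$ in the one-point compactification of $C$. $G_\infty$ is the stabilizer of $\infty$; for a subgroup $\Gamma$, $\Gamma_\infty=\Gamma\cap G_\infty$. **Subgroups.** $A=\{a_t\mid t>0\}$, $a_t\zeta=t\zeta$; $N=\{n_Z\mid Z\in C'\}$, $n_Z\zeta=\zeta+Z$; $M$ is the group of orthogonal maps $\varphi$ of $C$ with $\varphi(e)=e$; all fix $\infty$. The geodesic inversion is $\sigma\zeta=\zeta^{-1}$, $\sigma0=\infty$, $\sigma\infty=0$. One has $G_\infty=MAN$ and each $g\in G\smallsetminus G_\infty$ is uniquely of the form $g=n_1\sigma ma_tn_2$ with $n_1,n_2\in N$, $m\in M$, $a_t\in A$. **Isometric spheres.** The height is $\mathrm{ht}(\zeta)=\mathrm{Re}\,\zeta$. The Cygan metric on $\overline D^g\smallsetminus\{\infty\}$ is $\varrho(\zeta_1,\zeta_2)=\big||\mathrm{Re}\,\zeta_1-\mathrm{Re}\,\zeta_2|+\mathrm{Im}\,\zeta_1-\mathrm{Im}\,\zeta_2\big|^{1/2}$. For $g=n_1\sigma ma_tn_2\in G\smallsetminus G_\infty$ put $R(g)=t^{-1/4}$, and let $I(g)$, $\mathrm{Ext}\,I(g)$, $\mathrm{Int}\,I(g)$ be the sets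 of $z\in D$ with $\varrho(z,g^{-1}\infty)=R(g)$, $>R(g)$, $<R(g)$, respectively. **Types and fundamental domains.** A subgroup $\Gamma$ of $G$ is of type (O) if $\bigcap_{g\in\Gamma\smallsetminus\Gamma_\infty}\mathrm{Ext}\,I(g)=D\smallsetminus\overline{\bigcup_{g\in\Gamma\smallsetminus\Gamma_\infty}\mathrm{Int}\,I(g)}$. A subset $T\subseteq G$ is of type (F) if for each $z\in D$ the maximum of $\{\mathrm{ht}(gz)\mid g\in\langle T\rangle\}$ exists, where $\langle T\rangle$ is the subgroup generated by $T$. A fundamental region for a subgroup $\Gamma$ in $D$ is an open set $Y\subseteq D$ such that the translates of $Y$ by any two distinct elements of $\Gamma$ are disjoint and $D=\bigcup_{g\in\Gamma}g\overline Y$; a fundamental domain is a connected fundamental region. Convex means geodesically convex: with any two points the set contains the geodesic segment of $D$ joining them. Closures are taken in $D$; an intersection over the empty index set is $D$. *)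

theory Defs
  imports "HOL-Analysis.Analysis" "HOL-Algebra.Bij" "HOL-Algebra.Generated_Groups"
begin

text \<open>
  The inner product space \<open>C\<close> is the type \<open>'a\<close>; all notions take the distinguished unit vector
  \<open>e\<close> as a parameter. The real line \<open>\<real>e\<close> is identified with \<open>\<real>\<close> only through \<open>Re_part\<close>.
\<close>

definition Re_part :: "'a::euclidean_space \<Rightarrow> 'a \<Rightarrow> real" where
  "Re_part e \<zeta> = inner \<zeta> e"

definition Im_part :: "'a::euclidean_space \<Rightarrow> 'a \<Rightarrow> 'a" where
  "Im_part e \<zeta> = \<zeta> - Re_part e \<zeta> *\<^sub>R e"

definition C_prime :: "'a::euclidean_space \<Rightarrow> 'a set" where
  "C_prime e = {z. orthogonal z e}"

definition conj_map :: "'a::euclidean_space \<Rightarrow> 'a \<Rightarrow> 'a" where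
  "conj_map e \<zeta> = Re_part e \<zeta> *\<^sub>R e - Im_part e \<zeta>"

definition C_inverse :: "'a::euclidean_space \<Rightarrow> 'a \<Rightarrow> 'a" where
  "C_inverse e \<zeta> = (1 / (norm \<zeta>)\<^sup>2) *\<^sub>R conj_map e \<zeta>"

definition D_space :: "'a::euclidean_space \<Rightarrow> 'a set" where
  "D_space e = {\<zeta>. Re_part e \<zeta> > 0}"


subsection \<open>The Riemannian metric\<close>

text \<open>
  \<open>S = {0<..} \<times> C_prime e\<close>, with tangent space \<open>\<real> \<times> C_prime e\<close> at every point. A left-invariant
  metric is determined by its value at the identity \<open>(1, 0)\<close>, by transporting tangent vectors at
  \<open>p\<close> with the differential of left translation by the inverse of \<open>p\<close>. The inner product of the
  product type is the standard one. Left translations are affine on the whole of \<open>real \<times> 'a\<close>, so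
  their differentials may be taken there.
\<close>

fun S_mult :: "real \<times> 'a::euclidean_space \<Rightarrow> real \<times> 'a \<Rightarrow> real \<times> 'a" where
  "S_mult (t1, Z1) (t2, Z2) = (t1 * t2, Z1 + t1 *\<^sub>R Z2)"

fun S_inverse :: "real \<times> 'a::euclidean_space \<Rightarrow> real \<times> 'a" where
  "S_inverse (t, Z) = (1 / t, - ((1 / t) *\<^sub>R Z))"

definition S_metric ::
  "real \<times> 'a::euclidean_space \<Rightarrow> real \<times> 'a \<Rightarrow> real \<times> 'a \<Rightarrow> real" where
  "S_metric p u v =
     inner (frechet_derivative (S_mult (S_inverse p)) (at p) u)
           (frechet_derivative (S_mult (S_inverse p)) (at p) v)"

text \<open>
  \<open>S_chart\<close> is the inverse of the map \<open>(t, Z) \<mapsto> t e + Z\<close> from \<open>S\<close> onto \<open>D\<close>; it is the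
  restriction of a linear map, hence its own differential.
\<close>

definition S_chart :: "'a::euclidean_space \<Rightarrow> 'a \<Rightarrow> real \<times> 'a" where
  "S_chart e \<zeta> = (Re_part e \<zeta>, Im_part e \<zeta>)"

definition D_metric :: "'a::euclidean_space \<Rightarrow> 'a \<Rightarrow> 'a \<Rightarrow> 'a \<Rightarrow> real" where
  "D_metric e \<zeta> u v = S_metric (S_chart e \<zeta>) (S_chart e u) (S_chart e v)"

lemma S_inverse_left:
  assumes "t > 0"
  shows "S_mult (S_inverse (t, Z)) (t, Z) = (1, 0)"
  using assms by simp

lemma D_metric_eq:
  fixes e :: "'a::euclidean_space"
  assumes "norm e = 1" "\<zeta> \<in> D_space e"
  shows "D_metric e \<zeta> u v = inner u v / (Re_part e \<zeta>)\<^sup>2"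
proof -
  define t where "t = Re_part e \<zeta>"
  define Z where "Z = Im_part e \<zeta>"
  have eq: "S_mult (S_inverse (t, Z)) = (\<lambda>w. (- ((1 / t) *\<^sub>R (0, Z))) + (1 / t) *\<^sub>R w)"
    by (auto simp: fun_eq_iff)
  have "(S_mult (S_inverse (t, Z)) has_derivative (\<lambda>w. (1 / t) *\<^sub>R w)) (at p)" for p
    unfolding eq by (auto intro!: derivative_eq_intros)
  then have fd: "frechet_derivative (S_mult (S_inverse (t, Z))) (at p) = (\<lambda>w. (1 / t) *\<^sub>R w)" for p
    by (rule frechet_derivative_at[symmetric])
  have ee: "inner e e = 1"
    using assms(1) by (simp add: dot_square_norm)
  then have "inner (S_chart e u) (S_chart e v) = inner u v"
    by (simp add: S_chart_def Re_part_def Im_part_def inner_diff_left inner_diff_right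
        inner_commute[of e v])
  then show ?thesis
    unfolding D_metric_def S_metric_def S_chart_def[of e \<zeta>] t_def[symmetric] Z_def[symmetric] fd
    by (simp add: power2_eq_square)
qed


subsection \<open>Riemannian distance and geodesic convexity\<close>

definition has_D_length :: "'a::euclidean_space \<Rightarrow> (real \<Rightarrow> 'a) \<Rightarrow> real \<Rightarrow> bool" where
  "has_D_length e \<gamma> L \<longleftrightarrow>
     ((\<lambda>t. sqrt (D_metric e (\<gamma> t) (vector_derivative \<gamma> (at t)) (vector_derivative \<gamma> (at t))))
        has_integral L) {0..1}"

text \<open>
  \<open>valid_path\<close> means piecewise continuously differentiable, but does not require the one-sided
  limits of the derivative at the exceptional points; curves without a finite length are excluded
  by \<open>has_D_length\<close>.
\<close>

definition D_dist :: "'a::euclidean_space \<Rightarrow> 'a \<Rightarrow> 'a \<Rightarrow> real" where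
  "D_dist e x y = Inf {L. \<exists>\<gamma>. valid_path \<gamma> \<and> path_image \<gamma> \<subseteq> D_space e \<and>
                            pathstart \<gamma> = x \<and> pathfinish \<gamma> = y \<and> has_D_length e \<gamma> L}"

text \<open>
  Unit speed parametrisation of a geodesic segment. As \<open>D\<close> is a Hadamard manifold, its Riemannian
  geodesic segments are exactly the distance-realising curves, and two points are joined by
  exactly one segment.
\<close>

definition geodesic_segment ::
  "'a::euclidean_space \<Rightarrow> (real \<Rightarrow> 'a) \<Rightarrow> real \<Rightarrow> 'a \<Rightarrow> 'a \<Rightarrow> bool" where
  "geodesic_segment e \<gamma> l x y \<longleftrightarrow>
     0 \<le> l \<and> \<gamma> ` {0..l} \<subseteq> D_space e \<and> \<gamma> 0 = x \<and> \<gamma> l = y \<and>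
     (\<forall>s\<in>{0..l}. \<forall>t\<in>{0..l}. D_dist e (\<gamma> s) (\<gamma> t) = \<bar>s - t\<bar>)"

definition geodesically_convex :: "'a::euclidean_space \<Rightarrow> 'a set \<Rightarrow> bool" where
  "geodesically_convex e Y \<longleftrightarrow>
     (\<forall>x\<in>Y. \<forall>y\<in>Y. \<forall>\<gamma> l. geodesic_segment e \<gamma> l x y \<longrightarrow> \<gamma> ` {0..l} \<subseteq> Y)"


subsection \<open>The isometry group\<close>

text \<open>\<open>k\<close> times continuous differentiability on an open set.\<close>

primrec Ck_on ::
  "nat \<Rightarrow> ('a::real_normed_vector \<Rightarrow> 'b::real_normed_vector) \<Rightarrow> 'a set \<Rightarrow> bool" where
  "Ck_on 0 f U \<longleftrightarrow> continuous_on U f"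
| "Ck_on (Suc k) f U \<longleftrightarrow> (\<forall>x\<in>U. f differentiable (at x)) \<and>
     (\<forall>v. Ck_on k (\<lambda>x. frechet_derivative f (at x) v) U)"

definition smooth_map_on ::
  "'a::real_normed_vector set \<Rightarrow> ('a \<Rightarrow> 'b::real_normed_vector) \<Rightarrow> bool" where
  "smooth_map_on U f \<longleftrightarrow> (\<forall>k. Ck_on k f U)"

text \<open>
  Isometries are represented by functions that are extensional on \<open>D\<close>, so that equality of
  functions is equality on \<open>D\<close> and the group operation is that of \<open>BijGroup\<close>.
\<close>

definition D_isometries :: "'a::euclidean_space \<Rightarrow> ('a \<Rightarrow> 'a) set" where
  "D_isometries e =
     {g \<in> Bij (D_space e).
        smooth_map_on (D_space e) g \<and> smooth_map_on (D_space e) (inv_into (D_space e) g) \<and>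
        (\<forall>\<zeta>\<in>D_space e. \<forall>u v.
           D_metric e (g \<zeta>) (frechet_derivative g (at \<zeta>) u) (frechet_derivative g (at \<zeta>) v)
             = D_metric e \<zeta> u v)}"

definition G_group :: "'a::euclidean_space \<Rightarrow> ('a \<Rightarrow> 'a) monoid" where
  "G_group e = (BijGroup (D_space e))\<lparr>carrier := D_isometries e\<rparr>"


subsection \<open>The action on the closure; the stabilizer of infinity\<close>

text \<open>In the one-point compactification, \<open>None\<close> is the point at infinity.\<close>

definition D_closure :: "'a::euclidean_space \<Rightarrow> 'a option set" where
  "D_closure e = insert None (Some ` {\<zeta>. Re_part e \<zeta> \<ge> 0})"

definition D_closure_top :: "'a::euclidean_space \<Rightarrow> 'a option topology" where
  "D_closure_top e = subtopology (Alexandroff_compactification euclidean) (D_closure e)"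

text \<open>
  The continuous extension is unique because \<open>D\<close> is dense in the Hausdorff space \<open>D_closure e\<close>.
\<close>

definition bdry_ext :: "'a::euclidean_space \<Rightarrow> ('a \<Rightarrow> 'a) \<Rightarrow> 'a option \<Rightarrow> 'a option" where
  "bdry_ext e g = (THE h. h \<in> extensional (D_closure e) \<and>
                      continuous_map (D_closure_top e) (D_closure_top e) h \<and>
                      (\<forall>\<zeta>\<in>D_space e. h (Some \<zeta>) = Some (g \<zeta>)))"

definition G_inf :: "'a::euclidean_space \<Rightarrow> ('a \<Rightarrow> 'a) set" where
  "G_inf e = {g \<in> carrier (G_group e). bdry_ext e g None = None}"

definition stab_inf :: "'a::euclidean_space \<Rightarrow> ('a \<Rightarrow> 'a) set \<Rightarrow> ('a \<Rightarrow> 'a) set" where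
  "stab_inf e \<Gamma> = \<Gamma> \<inter> G_inf e"


subsection \<open>Isometric spheres\<close>

definition a_map :: "real \<Rightarrow> 'a::euclidean_space \<Rightarrow> 'a" where
  "a_map t \<zeta> = t *\<^sub>R \<zeta>"

definition n_map :: "'a::euclidean_space \<Rightarrow> 'a \<Rightarrow> 'a" where
  "n_map Z \<zeta> = \<zeta> + Z"

definition M_maps :: "'a::euclidean_space \<Rightarrow> ('a \<Rightarrow> 'a) set" where
  "M_maps e = {\<phi>. orthogonal_transformation \<phi> \<and> \<phi> e = e}"

text \<open>The following two definitions are meaningful for \<open>g\<close> outside \<open>G_inf e\<close>.\<close>

definition A_param :: "'a::euclidean_space \<Rightarrow> ('a \<Rightarrow> 'a) \<Rightarrow> real" where
  "A_param e g = (THE t. t > 0 \<and>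
     (\<exists>Z1\<in>C_prime e. \<exists>\<phi>\<in>M_maps e. \<exists>Z2\<in>C_prime e. \<forall>\<zeta>\<in>D_space e.
        g \<zeta> = (n_map Z1 \<circ> C_inverse e \<circ> \<phi> \<circ> a_map t \<circ> n_map Z2) \<zeta>))"

definition R_radius :: "'a::euclidean_space \<Rightarrow> ('a \<Rightarrow> 'a) \<Rightarrow> real" where
  "R_radius e g = A_param e g powr (- 1 / 4)"

definition ht :: "'a::euclidean_space \<Rightarrow> 'a \<Rightarrow> real" where
  "ht e \<zeta> = Re_part e \<zeta>"

definition cygan :: "'a::euclidean_space \<Rightarrow> 'a \<Rightarrow> 'a \<Rightarrow> real" where
  "cygan e \<zeta>1 \<zeta>2 =
     sqrt (norm (\<bar>Re_part e \<zeta>1 - Re_part e \<zeta>2\<bar> *\<^sub>R e + Im_part e \<zeta>1 - Im_part e \<zeta>2))"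

text \<open>
  The point \<open>g\<^sup>-\<^sup>1\<infinity>\<close>; it is finite for \<open>g\<close> outside \<open>G_inf e\<close>, which justifies \<open>the\<close>.
\<close>

definition iso_center :: "'a::euclidean_space \<Rightarrow> ('a \<Rightarrow> 'a) \<Rightarrow> 'a" where
  "iso_center e g = the (bdry_ext e (inv\<^bsub>G_group e\<^esub> g) None)"

definition Ext_I :: "'a::euclidean_space \<Rightarrow> ('a \<Rightarrow> 'a) \<Rightarrow> 'a set" where
  "Ext_I e g = {z \<in> D_space e. cygan e z (iso_center e g) > R_radius e g}"

definition Int_I :: "'a::euclidean_space \<Rightarrow> ('a \<Rightarrow> 'a) \<Rightarrow> 'a set" where
  "Int_I e g = {z \<in> D_space e. cygan e z (iso_center e g) < R_radius e g}"


subsection \<open>Types of subgroups, fundamental domains\<close>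

abbreviation D_cl :: "'a::euclidean_space \<Rightarrow> 'a set \<Rightarrow> 'a set" where
  "D_cl e Y \<equiv> top_of_set (D_space e) closure_of Y"

text \<open>
  In Isabelle an intersection over the empty index set is \<open>UNIV\<close>; intersecting with \<open>D_space e\<close>
  turns it into \<open>D\<close>.
\<close>

definition type_O :: "'a::euclidean_space \<Rightarrow> ('a \<Rightarrow> 'a) set \<Rightarrow> bool" where
  "type_O e \<Gamma> \<longleftrightarrow>
     D_space e \<inter> (\<Inter>g\<in>\<Gamma> - stab_inf e \<Gamma>. Ext_I e g)
       = D_space e - D_cl e (\<Union>g\<in>\<Gamma> - stab_inf e \<Gamma>. Int_I e g)"

definition type_F :: "'a::euclidean_space \<Rightarrow> ('a \<Rightarrow> 'a) set \<Rightarrow> bool" where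
  "type_F e T \<longleftrightarrow> T \<subseteq> carrier (G_group e) \<and>
     (\<forall>z\<in>D_space e. \<exists>h\<in>generate (G_group e) T.
        \<forall>g\<in>generate (G_group e) T. ht e (g z) \<le> ht e (h z))"

definition fundamental_region ::
  "'a::euclidean_space \<Rightarrow> ('a \<Rightarrow> 'a) set \<Rightarrow> 'a set \<Rightarrow> bool" where
  "fundamental_region e \<Gamma> Y \<longleftrightarrow>
     open Y \<and> Y \<subseteq> D_space e \<and>
     (\<forall>g\<in>\<Gamma>. \<forall>h\<in>\<Gamma>. g \<noteq> h \<longrightarrow> g ` Y \<inter> h ` Y = {}) \<and>
     D_space e = (\<Union>g\<in>\<Gamma>. g ` D_cl e Y)"

definition fundamental_domain ::
  "'a::euclidean_space \<Rightarrow> ('a \<Rightarrow> 'a) set \<Rightarrow> 'a set \<Rightarrow> bool" where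
  "fundamental_domain e \<Gamma> Y \<longleftrightarrow> fundamental_region e \<Gamma> Y \<and> connected Y"

end

theory Submission
  imports Defs
begin

text \<open>
  Let \<open>g \<in> \<Gamma>\<close> move \<open>\<infinity>\<close>. Then \<open>ht (g z) = R(g)\<^sup>4 ht z / |z - g\<^sup>-\<^sup>1\<infinity>|\<^sup>2\<close>, and so \<open>Ext I(g)\<close>
  has two descriptions: it is the exterior of a Euclidean half-ball centred on the boundary of
  \<open>D\<close> (\<open>isometric_sphere\<close>), and it consists of the points whose height \<open>g\<close> strictly lowers
  (\<open>Ext_I_iff_height_decreases\<close>).

  The first description makes \<open>Ext I(g)\<close> convex: if a geodesic between two points of the exterior
  met the half-ball, then replacing one endpoint by its reflection in the bounding sphere would not
  increase its distance to the other endpoint; but the sphere separates the reflected point from the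
  other endpoint, so the distance does increase (\<open>half_ball_exterior_convex\<close>). Hence \<open>\<F>\<close> is convex, and therefore connected.

  The second description makes \<open>\<F>\<close> a fundamental region. If two points \<open>x\<close> and \<open>y = g x\<close> of
  \<open>\<F>\<close> lie in one orbit and \<open>g\<close> moves \<open>\<infinity>\<close>, then \<open>g\<close> lowers the height of \<open>x\<close> and \<open>g\<^sup>-\<^sup>1\<close> lowers
  the height of \<open>y\<close>, which is absurd; if \<open>g\<close> fixes \<open>\<infinity>\<close>, the hypothesis on \<open>\<F>\<^sub>\<infinity>\<close> applies.
  Conversely, as soon as some element of \<open>\<Gamma>\<close> moves \<open>\<infinity>\<close>, the elements that do generate \<open>\<Gamma>\<close>, so by
  type (F) every orbit has a highest point. An element of \<open>\<Gamma>\<^sub>\<infinity>\<close> multiplies all heights by one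
  constant, and this constant is \<open>1\<close> because a highest point cannot be raised. Thus a highest
  point may be moved by \<open>\<Gamma>\<^sub>\<infinity>\<close> into the closure of \<open>\<F>\<^sub>\<infinity>\<close>. No \<open>g\<close> raises it, so it lies in the
  closure of every \<open>Ext I(g)\<close>, and the assumption on closures places it in the closure of \<open>\<F>\<close>.
  Type (O) is what makes \<open>\<F>\<close> open.

  Two facts about \<open>D\<close> carry this argument. The first is the distance formula
  \<open>2 cosh d(x,y) - 2 = |x - y|\<^sup>2 / (Re x Re y)\<close> (\<open>cosh_D_dist\<close>). Here the lower bound for
  the length of a path comes from calibrations: a smooth function whose gradient has hyperbolic norm
  at most \<open>1\<close> cannot vary along a path by more than the length of the path, and the logarithm of the
  ratio of the distances to the two ends of a geodesic is such a function, growing at unit rate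
  along that geodesic. The second is the normal form of an isometry \<open>g\<close>
  (\<open>chord_preserving_cases\<close>). Letting \<open>y\<close> tend to \<open>\<infinity>\<close> in the invariance of
  \<open>|x - y|\<^sup>2 / (Re x Re y)\<close> shows that \<open>Re x / Re (g x)\<close> is a polynomial
  \<open>\<beta> |x|\<^sup>2 - 2 w \<bullet> x + \<alpha>\<close> with \<open>\<alpha> \<beta> = |w|\<^sup>2\<close>: a constant, or a multiple of the squared distance
  to a boundary point. In the first case \<open>g\<close> is a Euclidean similarity; in the second it becomes one
  after composition with a translation and the geodesic inversion.
\<close>

section \<open>The half-space and its calibrated lines\<close>

text \<open>
  This is \<open>2 cosh d(x, y) - 2\<close> for the hyperbolic distance \<open>d\<close>; see \<open>cosh_D_dist\<close>.
\<close>

definition chord :: "'a::euclidean_space \<Rightarrow> 'a \<Rightarrow> 'a \<Rightarrow> real" where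
  "chord e x y = (norm (x - y))\<^sup>2 / (Re_part e x * Re_part e y)"

text \<open>
  A complete unit speed geodesic \<open>\<Gamma>\<close> together with a certificate \<open>h\<close> for its minimality: \<open>h\<close> has
  gradient of hyperbolic norm at most \<open>1\<close> everywhere and inverts \<open>\<Gamma>\<close>. The last conjunct is the
  distance formula along \<open>\<Gamma>\<close>; it holds everywhere because any two points lie on such a line.
\<close>

definition calibrated_line :: "'a::euclidean_space \<Rightarrow> (real \<Rightarrow> 'a) \<Rightarrow> ('a \<Rightarrow> real) \<Rightarrow> bool" where
  "calibrated_line e \<Gamma> h \<longleftrightarrow>
     (\<forall>s. \<Gamma> s \<in> D_space e \<and> h (\<Gamma> s) = s) \<and>
     (\<exists>\<Gamma>'. continuous_on UNIV \<Gamma>' \<and>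
        (\<forall>s. (\<Gamma> has_vector_derivative \<Gamma>' s) (at s) \<and> norm (\<Gamma>' s) = Re_part e (\<Gamma> s))) \<and>
     (\<exists>h'. \<forall>z\<in>D_space e. (h has_derivative h' z) (at z) \<and>
        (\<forall>v. \<bar>h' z v\<bar> \<le> norm v / Re_part e z)) \<and>
     (\<forall>s t. chord e (\<Gamma> s) (\<Gamma> t) = 2 * cosh (s - t) - 2)"

lemma Re_part_simps [simp]:
  "Re_part e (x + y) = Re_part e x + Re_part e y"
  "Re_part e (x - y) = Re_part e x - Re_part e y"
  "Re_part e (- x) = - Re_part e x"
  "Re_part e (c *\<^sub>R x) = c * Re_part e x"
  "Re_part e 0 = 0"
  by (simp_all add: Re_part_def inner_add_left inner_diff_left)

lemma C_prime_iff: "z \<in> C_prime e \<longleftrightarrow> Re_part e z = 0"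
  by (simp add: C_prime_def Re_part_def orthogonal_def)

lemma norm_scaled_diff_square:
  fixes x y :: "'a::real_inner"
  shows "(norm (\<alpha> *\<^sub>R x - \<beta> *\<^sub>R y))\<^sup>2 = \<alpha>\<^sup>2 * (norm x)\<^sup>2 - 2 * \<alpha> * \<beta> * inner x y + \<beta>\<^sup>2 * (norm y)\<^sup>2"
  unfolding power2_norm_eq_inner
  by (simp add: inner_diff_left inner_diff_right inner_commute[of y x] power2_eq_square algebra_simps)

locale half_space =
  fixes e :: "'a::euclidean_space"
  assumes norm_e: "norm e = 1"
begin

lemma inner_e_e [simp]: "inner e e = 1"
  using norm_e by (simp add: dot_square_norm)

lemma Re_part_e [simp]: "Re_part e e = 1"
  by (simp add: Re_part_def)

lemma Re_part_Im_part [simp]: "Re_part e (Im_part e z) = 0"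
  by (simp add: Im_part_def)

lemma Re_Im_decomp: "z = Re_part e z *\<^sub>R e + Im_part e z"
  by (simp add: Im_part_def)

lemma Re_part_le_norm: "\<bar>Re_part e z\<bar> \<le> norm z"
  using Cauchy_Schwarz_ineq2[of z e] norm_e by (simp add: Re_part_def)

lemma Im_part_C_prime: "Im_part e z \<in> C_prime e"
  by (simp add: C_prime_iff)

lemma open_D: "open (D_space e)"
proof -
  have "D_space e = {z. 0 < inner z e}" by (simp add: D_space_def Re_part_def)
  then show ?thesis by (simp add: open_Collect_less continuous_intros)
qed

lemma D_norm:
  assumes "z \<in> D_space e"
  shows "sqrt (D_metric e z v v) = norm v / Re_part e z"
  using assms D_metric_eq[OF norm_e assms, of v v]
  by (simp add: D_space_def real_sqrt_divide norm_eq_sqrt_inner)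

text \<open>
  The fundamental theorem of calculus for \<open>h \<circ> \<gamma>\<close>: the gradient bound says that the derivative of
  \<open>h \<circ> \<gamma>\<close> is at most the hyperbolic speed of \<open>\<gamma>\<close>.
\<close>

lemma calibration_le_length:
  assumes h: "\<And>z. z \<in> D_space e \<Longrightarrow> (h has_derivative h' z) (at z)"
    and bound: "\<And>z v. z \<in> D_space e \<Longrightarrow> \<bar>h' z v\<bar> \<le> norm v / Re_part e z"
    and \<gamma>: "valid_path \<gamma>" "path_image \<gamma> \<subseteq> D_space e" "has_D_length e \<gamma> L"
  shows "\<bar>h (pathfinish \<gamma>) - h (pathstart \<gamma>)\<bar> \<le> L"
proof -
  obtain S where S: "finite S" "\<gamma> C1_differentiable_on ({0..1} - S)" and cont: "continuous_on {0..1} \<gamma>"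
    using \<gamma>(1) by (auto simp: valid_path_def piecewise_C1_differentiable_on_def)
  have inD: "\<gamma> t \<in> D_space e" if "t \<in> {0..1}" for t
    using \<gamma>(2) that by (auto simp: path_image_def)
  define f' where "f' t = h' (\<gamma> t) (vector_derivative \<gamma> (at t))" for t
  have "((h \<circ> \<gamma>) has_vector_derivative f' t) (at t)" if t: "t \<in> {0<..<1} - S" for t
  proof -
    have "(\<gamma> has_vector_derivative vector_derivative \<gamma> (at t)) (at t)"
      using S(2) t by (auto simp: C1_differentiable_on_eq vector_derivative_works[symmetric])
    moreover have hd: "(h has_derivative h' (\<gamma> t)) (at (\<gamma> t))"
      using h inD t by auto
    ultimately have "((h \<circ> \<gamma>) has_derivative h' (\<gamma> t) \<circ> (\<lambda>x. x *\<^sub>R vector_derivative \<gamma> (at t))) (at t)"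
      unfolding has_vector_derivative_def by (intro diff_chain_at) auto
    moreover have "h' (\<gamma> t) \<circ> (\<lambda>x. x *\<^sub>R vector_derivative \<gamma> (at t)) = (\<lambda>x. x *\<^sub>R f' t)"
      using linear_scale[OF has_derivative_linear[OF hd]] by (auto simp: f'_def)
    ultimately show ?thesis by (simp add: has_vector_derivative_def)
  qed
  moreover have "continuous_on {0..1} (h \<circ> \<gamma>)"
  proof (rule continuous_on_compose[OF cont])
    have "continuous_on (D_space e) h"
      using h by (meson continuous_at_imp_continuous_on has_derivative_continuous)
    then show "continuous_on (\<gamma> ` {0..1}) h"
      using inD by (elim continuous_on_subset) auto
  qed
  ultimately have f': "(f' has_integral ((h \<circ> \<gamma>) 1 - (h \<circ> \<gamma>) 0)) {0..1}"
    by (intro fundamental_theorem_of_calculus_interior_strong[OF S(1)]) (auto simp: o_def)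
  have len: "((\<lambda>t. sqrt (D_metric e (\<gamma> t) (vector_derivative \<gamma> (at t)) (vector_derivative \<gamma> (at t))))
        has_integral L) {0..1}"
    using \<gamma>(3) by (simp add: has_D_length_def)
  have le: "\<bar>f' t\<bar> \<le> sqrt (D_metric e (\<gamma> t) (vector_derivative \<gamma> (at t)) (vector_derivative \<gamma> (at t)))"
    if "t \<in> {0..1}" for t
    using bound[OF inD[OF that]] D_norm[OF inD[OF that]] by (simp add: f'_def)
  have "(h \<circ> \<gamma>) 1 - (h \<circ> \<gamma>) 0 \<le> L"
    using le by (intro has_integral_le[OF f' len]) (auto simp: abs_le_iff)
  moreover have "- ((h \<circ> \<gamma>) 1 - (h \<circ> \<gamma>) 0) \<le> L"
    using le by (intro has_integral_le[OF has_integral_neg[OF f'] len]) (auto simp: abs_le_iff)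
  ultimately show ?thesis by (simp add: pathfinish_def pathstart_def abs_le_iff)
qed

lemma unit_speed_path:
  assumes inD: "\<And>s. \<Gamma> s \<in> D_space e"
    and deriv: "\<And>s. (\<Gamma> has_vector_derivative \<Gamma>' s) (at s)"
    and cont: "continuous_on UNIV \<Gamma>'"
    and speed: "\<And>s. norm (\<Gamma>' s) = Re_part e (\<Gamma> s)"
  shows "\<exists>\<gamma>. valid_path \<gamma> \<and> path_image \<gamma> \<subseteq> D_space e \<and> pathstart \<gamma> = \<Gamma> a \<and> pathfinish \<gamma> = \<Gamma> b \<and>
           has_D_length e \<gamma> \<bar>b - a\<bar>"
proof -
  define \<gamma> where "\<gamma> t = \<Gamma> (a + t * (b - a))" for t
  have der: "(\<gamma> has_vector_derivative (b - a) *\<^sub>R \<Gamma>' (a + t * (b - a))) (at t)" for t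
  proof -
    have "((\<lambda>t. a + t * (b - a)) has_vector_derivative (b - a)) (at t)"
      by (auto intro!: derivative_eq_intros simp: has_real_derivative_iff_has_vector_derivative[symmetric])
    from vector_diff_chain_at[OF this deriv] show ?thesis
      by (simp add: \<gamma>_def[abs_def] o_def)
  qed
  have "\<gamma> C1_differentiable_on {0..1}"
    unfolding C1_differentiable_on_def
    by (rule exI[of _ "\<lambda>t. (b - a) *\<^sub>R \<Gamma>' (a + t * (b - a))"])
       (auto intro!: der continuous_intros continuous_on_compose2[OF cont])
  then have "valid_path \<gamma>"
    by (simp add: valid_path_def C1_differentiable_imp_piecewise)
  moreover have "has_D_length e \<gamma> \<bar>b - a\<bar>"
  proof -
    have "sqrt (D_metric e (\<gamma> t) (vector_derivative \<gamma> (at t)) (vector_derivative \<gamma> (at t))) = \<bar>b - a\<bar>" for t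
    proof -
      have v: "vector_derivative \<gamma> (at t) = (b - a) *\<^sub>R \<Gamma>' (a + t * (b - a))"
        by (rule vector_derivative_at[OF der])
      have "\<gamma> t \<in> D_space e" by (simp add: \<gamma>_def inD)
      then have "Re_part e (\<gamma> t) > 0" by (simp add: D_space_def)
      then show ?thesis
        using D_norm[OF \<open>\<gamma> t \<in> D_space e\<close>] speed by (simp add: v \<gamma>_def)
    qed
    then show ?thesis
      using has_integral_const_real[of "\<bar>b - a\<bar>" 0 1] by (simp add: has_D_length_def)
  qed
  ultimately show ?thesis
    by (intro exI[of _ \<gamma>]) (auto simp: \<gamma>_def inD path_image_def pathstart_def pathfinish_def)
qed

text \<open>
  Along a vertical line, the logarithm of the height is the arc length.
\<close>

lemma vertical_calibrated_line:
  assumes Z: "Z \<in> C_prime e"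
  shows "calibrated_line e (\<lambda>s. exp s *\<^sub>R e + Z) (\<lambda>z. ln (Re_part e z))"
proof -
  have Z0: "Re_part e Z = 0" using Z by (simp add: C_prime_iff)
  have der: "((\<lambda>s. exp s *\<^sub>R e + Z) has_vector_derivative exp s *\<^sub>R e) (at s)" for s
    by (auto intro!: derivative_eq_intros)
  have h: "((\<lambda>z. ln (Re_part e z)) has_derivative (\<lambda>v. Re_part e v / Re_part e z)) (at z)"
    if "z \<in> D_space e" for z
    using that unfolding D_space_def Re_part_def
    by (auto intro!: derivative_eq_intros simp: field_simps)
  have chord: "chord e (exp s *\<^sub>R e + Z) (exp t *\<^sub>R e + Z) = 2 * cosh (s - t) - 2" for s t
  proof -
    have "exp s *\<^sub>R e + Z - (exp t *\<^sub>R e + Z) = (exp s - exp t) *\<^sub>R e"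
      by (simp add: algebra_simps)
    then have "chord e (exp s *\<^sub>R e + Z) (exp t *\<^sub>R e + Z) = (exp s - exp t)\<^sup>2 / (exp s * exp t)"
      by (simp add: chord_def Z0 norm_e)
    also have "\<dots> = exp s / exp t + exp t / exp s - 2"
      by (simp add: field_simps power2_eq_square)
    also have "\<dots> = 2 * cosh (s - t) - 2"
      by (simp add: cosh_def exp_diff exp_minus field_simps)
    finally show ?thesis .
  qed
  show ?thesis
    unfolding calibrated_line_def
  proof (intro conjI allI exI ballI)
    show "exp s *\<^sub>R e + Z \<in> D_space e" for s by (simp add: D_space_def Z0)
    show "ln (Re_part e (exp s *\<^sub>R e + Z)) = s" for s by (simp add: Z0)
    show "continuous_on UNIV (\<lambda>s. exp s *\<^sub>R e)" by (intro continuous_intros)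
    show "((\<lambda>s. exp s *\<^sub>R e + Z) has_vector_derivative exp s *\<^sub>R e) (at s)" for s by (rule der)
    show "norm (exp s *\<^sub>R e) = Re_part e (exp s *\<^sub>R e + Z)" for s by (simp add: Z0 norm_e)
    show "((\<lambda>z. ln (Re_part e z)) has_derivative (\<lambda>v. Re_part e v / Re_part e z)) (at z)"
      if "z \<in> D_space e" for z using that by (rule h)
    show "\<bar>Re_part e v / Re_part e z\<bar> \<le> norm v / Re_part e z" if "z \<in> D_space e" for z v
      using that Re_part_le_norm[of v] by (simp add: D_space_def divide_right_mono)
  qed (rule chord)
qed

text \<open>
  For \<open>z\<close> in \<open>D\<close>, twice the area of the triangle \<open>z p q\<close> is at least \<open>Re z |p - q|\<close>, because the
  altitude from \<open>z\<close> is at least \<open>Re z\<close>, and it is at most \<open>|z - p| |z - q|\<close>. This is the gradient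
  bound for the calibration of a semicircle with ends \<open>p\<close> and \<open>q\<close>. In coordinates, with \<open>k = Re z\<close>
  and \<open>A\<close>, \<open>B\<close> the imaginary parts of \<open>z - p\<close>, \<open>z - q\<close>, the squares of the two sides differ by
  \<open>(k\<^sup>2 + A \<bullet> B)\<^sup>2\<close> plus the defect in the Cauchy-Schwarz inequality for \<open>A\<close> and \<open>B\<close>.
\<close>

lemma height_times_chord_le:
  assumes "p \<in> C_prime e" "q \<in> C_prime e"
  shows "\<bar>Re_part e z\<bar> * norm (p - q) \<le> norm (z - p) * norm (z - q)"
proof -
  define k where "k = Re_part e z"
  define A where "A = Im_part e z - p"
  define B where "B = Im_part e z - q"
  have "Re_part e A = 0" "Re_part e B = 0"
    using assms by (simp_all add: A_def B_def C_prime_iff)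
  then have Ae: "inner A e = 0" "inner e A = 0" "inner B e = 0" "inner e B = 0"
    by (simp_all add: Re_part_def inner_commute)
  have zp: "z - p = k *\<^sub>R e + A" and zq: "z - q = k *\<^sub>R e + B" and pq: "p - q = B - A"
    using Re_Im_decomp[of z] by (simp_all add: k_def A_def B_def)
  have "(inner A B)\<^sup>2 \<le> inner A A * inner B B" by (rule Cauchy_Schwarz_ineq)
  moreover have "0 \<le> (k\<^sup>2 + inner A B)\<^sup>2" by simp
  ultimately have "k\<^sup>2 * (inner A A + inner B B - 2 * inner A B) \<le> (k\<^sup>2 + inner A A) * (k\<^sup>2 + inner B B)"
    by (simp add: power2_eq_square algebra_simps)
  also have "k\<^sup>2 * (inner A A + inner B B - 2 * inner A B) = (k * norm (p - q))\<^sup>2"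
    by (simp add: pq power_mult_distrib power2_norm_eq_inner inner_diff_left inner_diff_right
        inner_commute[of B A] algebra_simps)
  also have "(k\<^sup>2 + inner A A) * (k\<^sup>2 + inner B B) = (norm (z - p) * norm (z - q))\<^sup>2"
    unfolding zp zq power_mult_distrib power2_norm_eq_inner
    by (simp add: inner_add_left inner_add_right Ae power2_eq_square)
  finally have "\<bar>k * norm (p - q)\<bar> \<le> \<bar>norm (z - p) * norm (z - q)\<bar>"
    by (simp only: abs_le_square_iff)
  then show ?thesis by (simp add: abs_mult k_def)
qed

text \<open>
  The calibration is \<open>ln (|z - p| / |z - q|)\<close> for the two ends \<open>p = c - r u\<close> and \<open>q = c + r u\<close> of
  the semicircle. The gradient of this function has Euclidean norm \<open>|p - q| / (|z - p| |z - q|)\<close>,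
  which \<open>height_times_chord_le\<close> bounds by \<open>1 / Re z\<close>.
\<close>

lemma semicircle_calibrated_line:
  assumes c: "c \<in> C_prime e" and u: "u \<in> C_prime e" "norm u = 1" and r: "r > 0"
  shows "calibrated_line e (\<lambda>s. c + (r * tanh s) *\<^sub>R u + (r / cosh s) *\<^sub>R e)
           (\<lambda>z. (ln ((norm (z - (c - r *\<^sub>R u)))\<^sup>2) - ln ((norm (z - (c + r *\<^sub>R u)))\<^sup>2)) / 2)"
    (is "calibrated_line e ?\<Gamma> ?h")
proof -
  define p where "p = c - r *\<^sub>R u"
  define q where "q = c + r *\<^sub>R u"
  have pq: "p \<in> C_prime e" "q \<in> C_prime e"
    using c u by (simp_all add: p_def q_def C_prime_iff)
  have c0: "Re_part e c = 0" and u0: "Re_part e u = 0"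
    using c u(1) by (simp_all add: C_prime_iff)
  have ue: "inner u e = 0" "inner e u = 0" using u0 by (simp_all add: Re_part_def inner_commute)
  have uu: "inner u u = 1" using u(2) by (simp add: dot_square_norm)
  have cp: "cosh s > 0" for s :: real by (rule cosh_real_pos)
  have ch: "cosh s \<noteq> 0" for s :: real using cp[of s] by simp
  have ts: "tanh s = sinh s / cosh s" for s :: real by (simp add: tanh_def)
  have sq: "(sinh s)\<^sup>2 = (cosh s)\<^sup>2 - 1" for s :: real by (simp add: cosh_square_eq)
  have nrm: "(norm (\<alpha> *\<^sub>R u + \<beta> *\<^sub>R e))\<^sup>2 = \<alpha>\<^sup>2 + \<beta>\<^sup>2" for \<alpha> \<beta>
    unfolding power2_norm_eq_inner
    by (simp add: inner_add_left inner_add_right ue uu power2_eq_square)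
  have inD: "?\<Gamma> s \<in> D_space e" for s
    using cp r by (simp add: D_space_def c0 u0)
  have Re_\<Gamma>: "Re_part e (?\<Gamma> s) = r / cosh s" for s by (simp add: c0 u0)
  have np: "(norm (?\<Gamma> s - p))\<^sup>2 = 2 * r\<^sup>2 * (cosh s + sinh s) / cosh s" for s
  proof -
    have "?\<Gamma> s - p = (r * tanh s + r) *\<^sub>R u + (r / cosh s) *\<^sub>R e"
      by (simp add: p_def algebra_simps)
    then have "(norm (?\<Gamma> s - p))\<^sup>2 = (r * tanh s + r)\<^sup>2 + (r / cosh s)\<^sup>2"
      by (simp only: nrm)
    also have "\<dots> = r\<^sup>2 * (((sinh s + cosh s)\<^sup>2 + 1) / (cosh s)\<^sup>2)"
      using ch[of s] by (simp add: ts field_simps power2_eq_square)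
    also have "(sinh s + cosh s)\<^sup>2 + 1 = 2 * cosh s * (cosh s + sinh s)"
      using sq[of s] by (simp add: power2_eq_square algebra_simps)
    finally show ?thesis using ch[of s] by (simp add: power2_eq_square)
  qed
  have nq: "(norm (?\<Gamma> s - q))\<^sup>2 = 2 * r\<^sup>2 * (cosh s - sinh s) / cosh s" for s
  proof -
    have "?\<Gamma> s - q = (r * tanh s - r) *\<^sub>R u + (r / cosh s) *\<^sub>R e"
      by (simp add: q_def algebra_simps)
    then have "(norm (?\<Gamma> s - q))\<^sup>2 = (r * tanh s - r)\<^sup>2 + (r / cosh s)\<^sup>2"
      by (simp only: nrm)
    also have "\<dots> = r\<^sup>2 * (((sinh s - cosh s)\<^sup>2 + 1) / (cosh s)\<^sup>2)"
      using ch[of s] by (simp add: ts field_simps power2_eq_square)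
    also have "(sinh s - cosh s)\<^sup>2 + 1 = 2 * cosh s * (cosh s - sinh s)"
      using sq[of s] by (simp add: power2_eq_square algebra_simps)
    finally show ?thesis using ch[of s] by (simp add: power2_eq_square)
  qed
  have h: "?h (?\<Gamma> s) = s" for s
  proof -
    have "ln ((norm (?\<Gamma> s - p))\<^sup>2) - ln ((norm (?\<Gamma> s - q))\<^sup>2) =
        ln (((2 * r\<^sup>2 * (cosh s + sinh s) / cosh s)) / (2 * r\<^sup>2 * (cosh s - sinh s) / cosh s))"
      unfolding np nq
      using cp[of s] r
      by (subst ln_div) (simp_all add: cosh_plus_sinh cosh_minus_sinh)
    also have "(2 * r\<^sup>2 * (cosh s + sinh s) / cosh s) / (2 * r\<^sup>2 * (cosh s - sinh s) / cosh s) = exp (2 * s)"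
      using ch[of s] r mult_exp_exp[of s s]
      by (simp add: cosh_plus_sinh cosh_minus_sinh exp_minus field_simps)
    finally show ?thesis by (simp add: p_def q_def)
  qed
  define \<Gamma>' where "\<Gamma>' s = (r * (1 - (tanh s)\<^sup>2)) *\<^sub>R u + (- r * sinh s / (cosh s)\<^sup>2) *\<^sub>R e" for s
  have der: "(?\<Gamma> has_vector_derivative \<Gamma>' s) (at s)" for s
  proof -
    have "((\<lambda>s. r * tanh s) has_real_derivative r * (1 - (tanh s)\<^sup>2)) (at s)"
      using ch[of s] by (auto intro!: derivative_eq_intros)
    moreover have "((\<lambda>s. r / cosh s) has_real_derivative - r * sinh s / (cosh s)\<^sup>2) (at s)"
      using ch[of s] by (auto intro!: derivative_eq_intros simp: power2_eq_square)
    ultimately show ?thesis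
      unfolding \<Gamma>'_def by (auto intro!: derivative_eq_intros simp: power2_eq_square mult.commute)
  qed
  have speed: "norm (\<Gamma>' s) = r / cosh s" for s
  proof -
    have "(norm (\<Gamma>' s))\<^sup>2 = (r * (1 - (tanh s)\<^sup>2))\<^sup>2 + (- r * sinh s / (cosh s)\<^sup>2)\<^sup>2"
      unfolding \<Gamma>'_def by (rule nrm)
    also have "1 - (tanh s)\<^sup>2 = 1 / (cosh s)\<^sup>2"
      using ch[of s] sq[of s] by (simp add: ts field_simps power_divide)
    also have "(r * (1 / (cosh s)\<^sup>2))\<^sup>2 + (- r * sinh s / (cosh s)\<^sup>2)\<^sup>2 = (r / cosh s)\<^sup>2 * ((1 + (sinh s)\<^sup>2) / (cosh s)\<^sup>2)"
      using ch[of s] by (simp add: field_simps power2_eq_square)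
    also have "(1 + (sinh s)\<^sup>2) / (cosh s)\<^sup>2 = 1"
      using ch[of s] sq[of s] by simp
    finally show ?thesis
      using cp[of s] r by (simp add: power2_eq_iff_nonneg)
  qed
  have hder: "(?h has_derivative (\<lambda>v. inner (z - p) v / (norm (z - p))\<^sup>2 - inner (z - q) v / (norm (z - q))\<^sup>2)) (at z)"
    and zpq: "z \<noteq> p" "z \<noteq> q"
    if z: "z \<in> D_space e" for z
  proof -
    show zpq: "z \<noteq> p" "z \<noteq> q"
      using z pq by (auto simp: D_space_def C_prime_iff)
    have d: "((\<lambda>z. ln ((norm (z - w))\<^sup>2)) has_derivative (\<lambda>v. 2 * (inner (z - w) v / (norm (z - w))\<^sup>2))) (at z)"
      if "z \<noteq> w" for w
      unfolding power2_norm_eq_inner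
      using that
      by (auto intro!: derivative_eq_intros simp: inner_commute field_simps)
    have "(?h has_derivative (\<lambda>v. (2 * (inner (z - p) v / (norm (z - p))\<^sup>2) - 2 * (inner (z - q) v / (norm (z - q))\<^sup>2)) / 2)) (at z)"
      unfolding p_def[symmetric] q_def[symmetric]
      using has_derivative_scaleR_right[OF has_derivative_diff[OF d[OF zpq(1)] d[OF zpq(2)]], of "1/2"]
      by simp
    then show "(?h has_derivative (\<lambda>v. inner (z - p) v / (norm (z - p))\<^sup>2 - inner (z - q) v / (norm (z - q))\<^sup>2)) (at z)"
      by (simp add: diff_divide_distrib)
  qed
  have bound: "\<bar>inner (z - p) v / (norm (z - p))\<^sup>2 - inner (z - q) v / (norm (z - q))\<^sup>2\<bar> \<le> norm v / Re_part e z"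
    if z: "z \<in> D_space e" for z v
  proof -
    have kz: "Re_part e z > 0" using z by (simp add: D_space_def)
    define a where "a = norm (z - p)"
    define b where "b = norm (z - q)"
    have ab: "a > 0" "b > 0" using zpq[OF z] by (simp_all add: a_def b_def)
    define w where "w = (1 / a\<^sup>2) *\<^sub>R (z - p) - (1 / b\<^sup>2) *\<^sub>R (z - q)"
    have eq: "inner (z - p) v / a\<^sup>2 - inner (z - q) v / b\<^sup>2 = inner w v"
      by (simp add: w_def inner_diff_left)
    have ip: "2 * inner (z - p) (z - q) = a\<^sup>2 + b\<^sup>2 - (norm (p - q))\<^sup>2"
      unfolding a_def b_def power2_norm_eq_inner
      by (simp add: inner_diff_left inner_diff_right inner_commute algebra_simps)
    have "(norm w)\<^sup>2 = 1 / a\<^sup>2 + 1 / b\<^sup>2 - (2 * inner (z - p) (z - q)) / (a\<^sup>2 * b\<^sup>2)"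
    proof -
      have "(norm w)\<^sup>2 = (1 / a\<^sup>2)\<^sup>2 * a\<^sup>2 - 2 * (1 / a\<^sup>2) * (1 / b\<^sup>2) * inner (z - p) (z - q) + (1 / b\<^sup>2)\<^sup>2 * b\<^sup>2"
        unfolding w_def a_def b_def by (rule norm_scaled_diff_square)
      moreover have "(1 / a\<^sup>2)\<^sup>2 * a\<^sup>2 = 1 / a\<^sup>2" "(1 / b\<^sup>2)\<^sup>2 * b\<^sup>2 = 1 / b\<^sup>2"
        using ab by (simp_all add: power2_eq_square)
      ultimately show ?thesis by simp
    qed
    also have "\<dots> = (norm (p - q) / (a * b))\<^sup>2"
      unfolding ip using ab by (simp add: field_simps power2_eq_square)
    finally have nw: "norm w = norm (p - q) / (a * b)"
      using ab by (simp add: power2_eq_iff_nonneg)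
    have "Re_part e z * norm (p - q) \<le> a * b"
      using height_times_chord_le[OF pq, of z] kz by (simp add: a_def b_def)
    then have "norm w \<le> 1 / Re_part e z"
      using ab kz by (simp add: nw field_simps)
    then have "norm w * norm v \<le> 1 / Re_part e z * norm v"
      by (rule mult_right_mono) simp
    then show ?thesis
      using Cauchy_Schwarz_ineq2[of w v] eq by (simp add: a_def b_def)
  qed
  have chord: "chord e (?\<Gamma> s) (?\<Gamma> t) = 2 * cosh (s - t) - 2" for s t
  proof -
    have "?\<Gamma> s - ?\<Gamma> t = (r * tanh s - r * tanh t) *\<^sub>R u + (r / cosh s - r / cosh t) *\<^sub>R e"
      by (simp add: algebra_simps)
    then have "(norm (?\<Gamma> s - ?\<Gamma> t))\<^sup>2 = (r * tanh s - r * tanh t)\<^sup>2 + (r / cosh s - r / cosh t)\<^sup>2"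
      by (simp only: nrm)
    also have "\<dots> = r\<^sup>2 * (((sinh s * cosh t - sinh t * cosh s)\<^sup>2 + (cosh t - cosh s)\<^sup>2) / ((cosh s)\<^sup>2 * (cosh t)\<^sup>2))"
      using ch[of s] ch[of t] by (simp add: ts field_simps power2_eq_square)
    finally have "chord e (?\<Gamma> s) (?\<Gamma> t)
       = ((sinh s * cosh t - sinh t * cosh s)\<^sup>2 + (cosh t - cosh s)\<^sup>2) / (cosh s * cosh t)"
      unfolding chord_def Re_\<Gamma> using ch[of s] ch[of t] r
      by (simp add: field_simps power2_eq_square)
    also have "(sinh s * cosh t - sinh t * cosh s)\<^sup>2 + (cosh t - cosh s)\<^sup>2
        = 2 * (cosh s * cosh t) * (cosh s * cosh t - sinh s * sinh t) - 2 * (cosh s * cosh t)"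
    proof -
      have "(sinh s * cosh t - sinh t * cosh s)\<^sup>2 =
          (sinh s)\<^sup>2 * (cosh t)\<^sup>2 + (sinh t)\<^sup>2 * (cosh s)\<^sup>2 - 2 * (cosh s * cosh t) * (sinh s * sinh t)"
        by (simp add: power2_eq_square algebra_simps)
      then show ?thesis
        by (simp only: sq) (simp add: power2_eq_square algebra_simps)
    qed
    also have "cosh s * cosh t - sinh s * sinh t = cosh (s - t)"
      by (simp add: cosh_diff)
    also have "(2 * (cosh s * cosh t) * cosh (s - t) - 2 * (cosh s * cosh t)) / (cosh s * cosh t) = 2 * cosh (s - t) - 2"
      using ch[of s] ch[of t] by (simp add: diff_divide_distrib)
    finally show ?thesis .
  qed
  have cont: "continuous_on UNIV \<Gamma>'"
    unfolding \<Gamma>'_def using ch by (intro continuous_intros) auto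
  show ?thesis
    unfolding calibrated_line_def
  proof (intro conjI allI ballI exI[of _ "\<Gamma>'"]
      exI[of _ "\<lambda>z v. inner (z - p) v / (norm (z - p))\<^sup>2 - inner (z - q) v / (norm (z - q))\<^sup>2"])
    show "norm (\<Gamma>' s) = Re_part e (?\<Gamma> s)" for s
      unfolding Re_\<Gamma> by (rule speed)
  qed (rule inD h cont der hder bound chord | assumption)+
qed

section \<open>The hyperbolic distance and geodesic convexity\<close>

text \<open>
  Two points with the same imaginary part lie on a vertical line. Otherwise the centre of the
  semicircle through them is the point on the boundary line through their projections that is
  equidistant from both, and \<open>arsinh\<close> provides the parameters.
\<close>

lemma calibrated_line_through:
  assumes x: "x \<in> D_space e" and y: "y \<in> D_space e"
  obtains \<Gamma> h a b where "calibrated_line e \<Gamma> h" "\<Gamma> a = x" "\<Gamma> b = y"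
proof (cases "Im_part e x = Im_part e y")
  case True
  have "exp (ln (Re_part e z)) *\<^sub>R e + Im_part e x = z" if "z \<in> {x, y}" for z
  proof -
    have "exp (ln (Re_part e z)) = Re_part e z" "Im_part e x = Im_part e z"
      using that x y True by (auto simp: D_space_def)
    then show ?thesis using Re_Im_decomp[of z] by simp
  qed
  then show thesis
    using that[OF vertical_calibrated_line[OF Im_part_C_prime[of x]]] by blast
next
  case False
  define d where "d = norm (Im_part e y - Im_part e x)"
  define u where "u = (1 / d) *\<^sub>R (Im_part e y - Im_part e x)"
  have d: "d > 0" using False by (simp add: d_def)
  have u: "u \<in> C_prime e" "norm u = 1"
    using d by (simp_all add: u_def C_prime_iff) (simp add: d_def)
  define k where "k = Re_part e x"
  define l where "l = Re_part e y"
  have kl: "k > 0" "l > 0" using x y by (simp_all add: k_def l_def D_space_def)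
  define m where "m = (d\<^sup>2 + l\<^sup>2 - k\<^sup>2) / (2 * d)"
  define c where "c = Im_part e x + m *\<^sub>R u"
  have c: "c \<in> C_prime e" using u by (simp add: c_def C_prime_iff)
  define r where "r = sqrt (k\<^sup>2 + m\<^sup>2)"
  have r: "r > 0" unfolding r_def using kl by (simp add: add_pos_nonneg)
  have r1: "r\<^sup>2 = (- m)\<^sup>2 + k\<^sup>2" by (simp add: r_def)
  have r2: "r\<^sup>2 = (d - m)\<^sup>2 + l\<^sup>2"
    unfolding r1 m_def using d by (simp add: field_simps power2_eq_square)
  have xeq: "x = c + (- m) *\<^sub>R u + k *\<^sub>R e"
    using Re_Im_decomp[of x] by (simp add: c_def k_def add.commute)
  have yeq: "y = c + (d - m) *\<^sub>R u + l *\<^sub>R e"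
  proof -
    have "d *\<^sub>R u = Im_part e y - Im_part e x" using d by (simp add: u_def)
    then show ?thesis
      using Re_Im_decomp[of y] by (simp add: c_def l_def algebra_simps)
  qed
  \<comment> \<open>The point with horizontal coordinate \<open>p\<close> and height \<open>k'\<close> on the semicircle has
    parameter \<open>s\<close> with \<open>sinh s = p / k'\<close>.\<close>
  have par: "\<exists>s. r * tanh s = p \<and> r / cosh s = k'" if "r\<^sup>2 = p\<^sup>2 + k'\<^sup>2" "k' > 0" for p k' :: real
  proof (intro exI conjI)
    have sh: "sinh (arsinh (p / k')) = p / k'" by simp
    have "(cosh (arsinh (p / k')))\<^sup>2 = (r / k')\<^sup>2"
      using cosh_square_eq[of "arsinh (p / k')"] that by (simp add: field_simps)
    then have chh: "cosh (arsinh (p / k')) = r / k'"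
      using r that by (simp add: power2_eq_iff_nonneg)
    show "r * tanh (arsinh (p / k')) = p" using r that by (simp add: tanh_def chh)
    show "r / cosh (arsinh (p / k')) = k'" using r that by (simp add: chh)
  qed
  obtain a where "r * tanh a = - m" "r / cosh a = k" using par[OF r1] kl by blast
  moreover obtain b where "r * tanh b = d - m" "r / cosh b = l" using par[OF r2] kl by blast
  ultimately show thesis
    using that[OF semicircle_calibrated_line[OF c u r], of a b] xeq yeq by presburger
qed

definition path_lengths :: "'a \<Rightarrow> 'a \<Rightarrow> real set" where
  "path_lengths x y = {L. \<exists>\<gamma>. valid_path \<gamma> \<and> path_image \<gamma> \<subseteq> D_space e \<and>
                            pathstart \<gamma> = x \<and> pathfinish \<gamma> = y \<and> has_D_length e \<gamma> L}"

lemma D_dist_eq_Inf: "D_dist e x y = Inf (path_lengths x y)"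
  by (simp add: D_dist_def path_lengths_def)

lemma calibrated_line_path:
  assumes "calibrated_line e \<Gamma> h"
  shows "\<bar>b - a\<bar> \<in> path_lengths (\<Gamma> a) (\<Gamma> b)"
  using assms unit_speed_path[of \<Gamma>] unfolding calibrated_line_def path_lengths_def by blast

lemma calibration_le_path_length:
  assumes "calibrated_line e \<Gamma> h" "L \<in> path_lengths x y"
  shows "\<bar>h y - h x\<bar> \<le> L"
  using assms calibration_le_length[of h] unfolding calibrated_line_def path_lengths_def by blast

lemma path_lengths_nonempty:
  assumes "x \<in> D_space e" "y \<in> D_space e"
  shows "path_lengths x y \<noteq> {}"
  using calibrated_line_through[OF assms] calibrated_line_path by (metis empty_iff)

text \<open>
  Nonemptiness of the set of lengths matters here: the infimum of the empty set is an unspecified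
  real number.
\<close>

lemma calibration_le_dist:
  assumes "calibrated_line e \<Gamma> h" "x \<in> D_space e" "y \<in> D_space e"
  shows "\<bar>h y - h x\<bar> \<le> D_dist e x y"
  unfolding D_dist_eq_Inf
  using calibration_le_path_length[OF assms(1)] path_lengths_nonempty[OF assms(2,3)]
  by (intro cInf_greatest) auto

lemma D_dist_calibrated_line:
  assumes "calibrated_line e \<Gamma> h"
  shows "D_dist e (\<Gamma> a) (\<Gamma> b) = \<bar>b - a\<bar>"
  unfolding D_dist_eq_Inf
proof (rule cInf_eq_minimum[OF calibrated_line_path[OF assms]])
  fix L assume "L \<in> path_lengths (\<Gamma> a) (\<Gamma> b)"
  moreover have "h (\<Gamma> s) = s" for s using assms by (simp add: calibrated_line_def)
  ultimately show "\<bar>b - a\<bar> \<le> L" using calibration_le_path_length[OF assms] by metis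
qed

lemma cosh_D_dist:
  assumes "x \<in> D_space e" "y \<in> D_space e"
  shows "D_dist e x y \<ge> 0" "chord e x y = 2 * cosh (D_dist e x y) - 2"
proof -
  obtain \<Gamma> h a b where G: "calibrated_line e \<Gamma> h" "\<Gamma> a = x" "\<Gamma> b = y"
    using calibrated_line_through[OF assms] .
  have d: "D_dist e x y = \<bar>b - a\<bar>" using D_dist_calibrated_line[OF G(1)] G by metis
  then show "D_dist e x y \<ge> 0" by simp
  have "chord e x y = 2 * cosh (a - b) - 2" using G by (auto simp: calibrated_line_def)
  moreover have "cosh (a - b) = cosh \<bar>b - a\<bar>" by (simp add: abs_minus_commute)
  ultimately show "chord e x y = 2 * cosh (D_dist e x y) - 2" by (simp add: d)
qed

text \<open>
  With a calibration \<open>h\<close> of the geodesic from \<open>x\<close> to \<open>z\<close>, the left side is \<open>h z - h x\<close>, and the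
  increments of \<open>h\<close> from \<open>x\<close> to \<open>y\<close> and from \<open>y\<close> to \<open>z\<close> are bounded by the distances.
\<close>

lemma D_dist_triangle:
  assumes "x \<in> D_space e" "y \<in> D_space e" "z \<in> D_space e"
  shows "D_dist e x z \<le> D_dist e x y + D_dist e y z"
proof -
  obtain \<Gamma> h a b where G: "calibrated_line e \<Gamma> h" "\<Gamma> a = x" "\<Gamma> b = z"
    using calibrated_line_through[OF assms(1,3)] .
  have "h x = a" "h z = b" using G by (auto simp: calibrated_line_def)
  then have "D_dist e x z = \<bar>h z - h x\<bar>" using D_dist_calibrated_line[OF G(1)] G by metis
  then show ?thesis
    using calibration_le_dist[OF G(1) assms(1,2)] calibration_le_dist[OF G(1) assms(2,3)] by linarith
qed

lemma D_dist_le_iff_chord_le: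
  assumes "x \<in> D_space e" "y \<in> D_space e" "x' \<in> D_space e" "y' \<in> D_space e"
  shows "D_dist e x y \<le> D_dist e x' y' \<longleftrightarrow> chord e x y \<le> chord e x' y'"
  using cosh_D_dist[OF assms(1,2)] cosh_D_dist[OF assms(3,4)]
  by (simp add: cosh_real_nonneg_le_iff)

lemma geodesic_segment_exists:
  assumes "x \<in> D_space e" "y \<in> D_space e"
  obtains \<gamma> l where "geodesic_segment e \<gamma> l x y" "continuous_on {0..l} \<gamma>"
proof -
  obtain \<Gamma> h a b where G: "calibrated_line e \<Gamma> h" "\<Gamma> a = x" "\<Gamma> b = y"
    using calibrated_line_through[OF assms] .
  define \<epsilon> where "\<epsilon> = (if a \<le> b then 1 else - 1 :: real)"
  define \<gamma> where "\<gamma> s = \<Gamma> (a + \<epsilon> * s)" for s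
  have inD: "\<Gamma> s \<in> D_space e" for s using G by (simp add: calibrated_line_def)
  have "continuous (at s) \<Gamma>" for s
    using G(1) unfolding calibrated_line_def by (meson has_vector_derivative_continuous)
  then have "continuous_on UNIV \<Gamma>" by (simp add: continuous_at_imp_continuous_on)
  then have "continuous_on {0..\<bar>b - a\<bar>} \<gamma>"
    unfolding \<gamma>_def by (auto intro!: continuous_on_compose2[of UNIV \<Gamma>] continuous_intros)
  moreover have "geodesic_segment e \<gamma> \<bar>b - a\<bar> x y"
    unfolding geodesic_segment_def
  proof (intro conjI ballI)
    show "D_dist e (\<gamma> s) (\<gamma> t) = \<bar>s - t\<bar>" for s t
      unfolding \<gamma>_def D_dist_calibrated_line[OF G(1)] by (auto simp: \<epsilon>_def)
    show "\<gamma> \<bar>b - a\<bar> = y" using G by (auto simp: \<gamma>_def \<epsilon>_def)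
  qed (use G inD in \<open>auto simp: \<gamma>_def\<close>)
  ultimately show thesis using that by blast
qed

lemma geodesically_convex_imp_connected:
  assumes "geodesically_convex e Y" "Y \<subseteq> D_space e"
  shows "connected Y"
  unfolding connected_iff_connected_component
proof (intro ballI)
  fix x y assume xy: "x \<in> Y" "y \<in> Y"
  then obtain \<gamma> l where g: "geodesic_segment e \<gamma> l x y" "continuous_on {0..l} \<gamma>"
    using geodesic_segment_exists assms(2) by (metis subsetD)
  have "connected (\<gamma> ` {0..l})" using g(2) by (rule connected_continuous_image) auto
  moreover have "\<gamma> ` {0..l} \<subseteq> Y" using assms(1) g(1) xy unfolding geodesically_convex_def by blast
  moreover have "x \<in> \<gamma> ` {0..l}" "y \<in> \<gamma> ` {0..l}"
    using g(1) unfolding geodesic_segment_def by force+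
  ultimately show "connected_component Y x y" unfolding connected_component_def by blast
qed

text \<open>
  Reflecting \<open>x\<close> in the sphere of radius \<open>r\<close> about the boundary point \<open>c\<close> brings it closer to
  exactly those \<open>y\<close> that lie on the other side of the sphere.
\<close>

lemma chord_sphere_inversion_diff:
  assumes "r > 0" "x \<noteq> c" "Re_part e x \<noteq> 0" "Re_part e y \<noteq> 0" "c \<in> C_prime e"
  shows "chord e (c + (r\<^sup>2 / (norm (x - c))\<^sup>2) *\<^sub>R (x - c)) y - chord e x y =
           ((norm (x - c))\<^sup>2 - r\<^sup>2) * ((norm (y - c))\<^sup>2 - r\<^sup>2) / (r\<^sup>2 * Re_part e x * Re_part e y)"
proof -
  define X where "X = x - c"
  define Y where "Y = y - c"
  have c0: "Re_part e c = 0" using assms(5) by (simp add: C_prime_iff)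
  define k where "k = r\<^sup>2 / (norm X)\<^sup>2"
  have N: "norm X \<noteq> 0" using assms(2) by (simp add: X_def)
  have E: "c + k *\<^sub>R X - y = k *\<^sub>R X - Y" by (simp add: Y_def)
  have "(norm (c + k *\<^sub>R X - y))\<^sup>2 = k\<^sup>2 * (norm X)\<^sup>2 - 2 * k * inner X Y + (norm Y)\<^sup>2"
    unfolding E using norm_scaled_diff_square[of k X 1 Y] by simp
  moreover have "Re_part e (c + k *\<^sub>R X) = k * Re_part e x" by (simp add: X_def c0)
  ultimately have 1: "chord e (c + k *\<^sub>R X) y = (k\<^sup>2 * (norm X)\<^sup>2 - 2 * k * inner X Y + (norm Y)\<^sup>2) / (k * Re_part e x * Re_part e y)"
    by (simp add: chord_def)
  have "x - y = X - Y" by (simp add: X_def Y_def)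
  then have 2: "chord e x y = ((norm X)\<^sup>2 - 2 * inner X Y + (norm Y)\<^sup>2) / (Re_part e x * Re_part e y)"
    by (simp add: chord_def power2_norm_eq_inner inner_diff_left inner_diff_right inner_commute)
  show ?thesis
    unfolding X_def[symmetric] Y_def[symmetric] k_def[symmetric] 1 2
    unfolding k_def using N assms(1,3,4) by (simp add: field_simps power2_eq_square)
qed

text \<open>
  Suppose that a geodesic from \<open>x\<close> to \<open>y\<close> meets the closed half-ball at \<open>w\<close>, and let \<open>x'\<close> be the
  reflection of \<open>x\<close> in the sphere. By \<open>chord_sphere_inversion_diff\<close> the point \<open>w\<close> is at least as
  close to \<open>x'\<close> as to \<open>x\<close>, so \<open>d(x', y) \<le> d(x', w) + d(w, y) \<le> d(x, y)\<close>. But \<open>y\<close> lies on the side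
  of \<open>x\<close> and is strictly closer to \<open>x\<close> than to \<open>x'\<close>.
\<close>

lemma half_ball_exterior_convex:
  assumes c: "c \<in> C_prime e" and r: "r > 0"
  shows "geodesically_convex e {z \<in> D_space e. norm (z - c) > r}"
  unfolding geodesically_convex_def
proof (intro ballI allI impI)
  fix x y \<gamma> l
  assume x: "x \<in> {z \<in> D_space e. norm (z - c) > r}" and y: "y \<in> {z \<in> D_space e. norm (z - c) > r}"
    and g: "geodesic_segment e \<gamma> l x y"
  define x' where "x' = c + (r\<^sup>2 / (norm (x - c))\<^sup>2) *\<^sub>R (x - c)"
  have c0: "Re_part e c = 0" using c by (simp add: C_prime_iff)
  have nz: "x \<noteq> c" using x r by auto
  have x'D: "x' \<in> D_space e"
    using x r nz by (simp add: x'_def D_space_def c0)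
  have diff: "chord e x' z - chord e x z = ((norm (x - c))\<^sup>2 - r\<^sup>2) * ((norm (z - c))\<^sup>2 - r\<^sup>2) / (r\<^sup>2 * Re_part e x * Re_part e z)"
    if "z \<in> D_space e" for z
    unfolding x'_def using chord_sphere_inversion_diff[OF r nz _ _ c] x that by (simp add: D_space_def)
  have xr: "(norm (x - c))\<^sup>2 - r\<^sup>2 > 0" and yr: "(norm (y - c))\<^sup>2 - r\<^sup>2 > 0"
    using x y r by (simp_all add: power_strict_mono)
  show "\<gamma> ` {0..l} \<subseteq> {z \<in> D_space e. norm (z - c) > r}"
  proof (rule ccontr)
    assume "\<not> ?thesis"
    then obtain s where "s \<in> {0..l}" "\<gamma> s \<notin> {z \<in> D_space e. norm (z - c) > r}" by blast
    moreover from this have "\<gamma> s \<in> D_space e"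
      using g unfolding geodesic_segment_def by blast
    ultimately have s: "s \<in> {0..l}" "norm (\<gamma> s - c) \<le> r" "\<gamma> s \<in> D_space e" by auto
    have l: "0 \<le> l" "\<gamma> 0 = x" "\<gamma> l = y" and dist: "\<And>s t. s \<in> {0..l} \<Longrightarrow> t \<in> {0..l} \<Longrightarrow> D_dist e (\<gamma> s) (\<gamma> t) = \<bar>s - t\<bar>"
      using g by (auto simp: geodesic_segment_def)
    have d: "D_dist e x (\<gamma> s) = s" "D_dist e (\<gamma> s) y = l - s" "D_dist e x y = l"
      using dist[of 0 s] dist[of s l] dist[of 0 l] l s by auto
    have "(norm (\<gamma> s - c))\<^sup>2 - r\<^sup>2 \<le> 0" using s(2) by (simp add: power_mono)
    then have "chord e x' (\<gamma> s) - chord e x (\<gamma> s) \<le> 0"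
      unfolding diff[OF s(3)] using xr r x s(3)
      by (intro divide_nonpos_nonneg) (auto simp: D_space_def mult_nonneg_nonpos)
    then have "D_dist e x' (\<gamma> s) \<le> D_dist e x (\<gamma> s)"
      using D_dist_le_iff_chord_le x'D s(3) x by simp
    then have "D_dist e x' y \<le> D_dist e x y"
      using D_dist_triangle[OF x'D s(3), of y] y d by simp
    moreover have "chord e x' y - chord e x y > 0"
      using diff[of y] y xr yr r x by (simp add: D_space_def)
    then have "\<not> D_dist e x' y \<le> D_dist e x y"
      using D_dist_le_iff_chord_le x'D y x by simp
    ultimately show False by simp
  qed
qed

end

section \<open>Invariance of the distance under isometries\<close>

lemma frechet_derivative_cong_open:
  assumes "open U" "x \<in> U" "\<And>x. x \<in> U \<Longrightarrow> f x = g x" "f differentiable (at x)"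
  shows "g differentiable (at x)" "frechet_derivative g (at x) = frechet_derivative f (at x)"
proof -
  have "(g has_derivative frechet_derivative f (at x)) (at x)"
    using assms(4)[unfolded frechet_derivative_works] assms(1-3)
    by (rule has_derivative_transform_within_open)
  then show "g differentiable (at x)" "frechet_derivative g (at x) = frechet_derivative f (at x)"
    by (auto simp: differentiable_def dest: frechet_derivative_at)
qed

text \<open>
  An isometry is specified only on \<open>D\<close>. This locality is what allows \<open>inv_into\<close>, whose values outside
  \<open>D\<close> are arbitrary, to be replaced by its extensional restriction.
\<close>

lemma Ck_on_cong:
  assumes "open U"
  shows "(\<And>x. x \<in> U \<Longrightarrow> f x = g x) \<Longrightarrow> Ck_on k f U \<Longrightarrow> Ck_on k g U"
proof (induction k arbitrary: f g)
  case 0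
  then show ?case using continuous_on_cong[of U U f g] by simp
next
  case (Suc k)
  have d: "f differentiable (at x)" if "x \<in> U" for x using Suc.prems(2) that by simp
  have "Ck_on k (\<lambda>x. frechet_derivative g (at x) v) U" for v
  proof (rule Suc.IH)
    show "Ck_on k (\<lambda>x. frechet_derivative f (at x) v) U" using Suc.prems(2) by simp
  qed (use frechet_derivative_cong_open(2)[OF assms _ Suc.prems(1) d] in auto)
  then show ?case
    using frechet_derivative_cong_open(1)[OF assms _ Suc.prems(1) d] by auto
qed

context half_space begin

text \<open>
  The part of the definition of an isometry that carries paths to paths of the same length, in a form
  that applies to an isometry and to its inverse alike.
\<close>

definition metric_preserving :: "('a \<Rightarrow> 'a) \<Rightarrow> bool" where
  "metric_preserving f \<longleftrightarrow> f ` D_space e \<subseteq> D_space e \<and> Ck_on 1 f (D_space e) \<and>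
     (\<forall>\<zeta>\<in>D_space e. \<forall>u v.
        D_metric e (f \<zeta>) (frechet_derivative f (at \<zeta>) u) (frechet_derivative f (at \<zeta>) v)
          = D_metric e \<zeta> u v)"

text \<open>
  The image path has the same speed wherever the given path is differentiable. At the finitely many
  remaining parameters \<open>vector_derivative\<close> is arbitrary, but the integral ignores them.
\<close>

lemma metric_preserving_path_lengths:
  assumes f: "metric_preserving f" and L: "L \<in> path_lengths x y"
  shows "L \<in> path_lengths (f x) (f y)"
proof -
  have fD: "f z \<in> D_space e" and fd: "f differentiable (at z)"
    and fm: "D_metric e (f z) (frechet_derivative f (at z) u) (frechet_derivative f (at z) v)
          = D_metric e z u v" if "z \<in> D_space e" for z u v
    using f that by (auto simp: metric_preserving_def)
  have fc: "continuous_on (D_space e) (\<lambda>z. frechet_derivative f (at z) v)" for v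
    using f by (simp add: metric_preserving_def)
  obtain \<gamma> where \<gamma>: "valid_path \<gamma>" "path_image \<gamma> \<subseteq> D_space e" "pathstart \<gamma> = x" "pathfinish \<gamma> = y"
      "has_D_length e \<gamma> L"
    using L by (auto simp: path_lengths_def)
  obtain S where S: "finite S" "\<gamma> C1_differentiable_on ({0..1} - S)" and cont: "continuous_on {0..1} \<gamma>"
    using \<gamma>(1) by (auto simp: valid_path_def piecewise_C1_differentiable_on_def)
  have inD: "\<gamma> t \<in> D_space e" if "t \<in> {0..1}" for t
    using \<gamma>(2) that by (auto simp: path_image_def)
  define v where "v t = vector_derivative \<gamma> (at t)" for t
  define w where "w t = frechet_derivative f (at (\<gamma> t)) (v t)" for t
  have der: "((f \<circ> \<gamma>) has_vector_derivative w t) (at t)" if t: "t \<in> {0..1} - S" for t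
  proof -
    have "(\<gamma> has_derivative (\<lambda>x. x *\<^sub>R v t)) (at t)"
      using S(2) t unfolding v_def has_vector_derivative_def[symmetric]
      by (auto simp: C1_differentiable_on_eq vector_derivative_works[symmetric])
    moreover have hd: "(f has_derivative frechet_derivative f (at (\<gamma> t))) (at (\<gamma> t))"
      using fd[OF inD] t by (auto simp: frechet_derivative_works[symmetric])
    ultimately have "((f \<circ> \<gamma>) has_derivative frechet_derivative f (at (\<gamma> t)) \<circ> (\<lambda>x. x *\<^sub>R v t)) (at t)"
      by (rule diff_chain_at)
    moreover have "frechet_derivative f (at (\<gamma> t)) \<circ> (\<lambda>x. x *\<^sub>R v t) = (\<lambda>x. x *\<^sub>R w t)"
      using linear_scale[OF has_derivative_linear[OF hd]] by (auto simp: w_def)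
    ultimately show ?thesis by (simp add: has_vector_derivative_def)
  qed
  \<comment> \<open>The derivative of \<open>f\<close> is continuous only for each fixed direction; expanding the velocity in
    the basis reduces continuity of the composite derivative to that.\<close>
  have w: "w t = (\<Sum>b\<in>Basis. (v t \<bullet> b) *\<^sub>R frechet_derivative f (at (\<gamma> t)) b)" if t: "t \<in> {0..1}" for t
  proof -
    have lin: "linear (frechet_derivative f (at (\<gamma> t)))"
      using fd[OF inD[OF t]] by (rule linear_frechet_derivative)
    have "frechet_derivative f (at (\<gamma> t)) (\<Sum>b\<in>Basis. (v t \<bullet> b) *\<^sub>R b)
        = (\<Sum>b\<in>Basis. (v t \<bullet> b) *\<^sub>R frechet_derivative f (at (\<gamma> t)) b)"
      by (simp add: linear_sum[OF lin] linear_scale[OF lin] del: euclidean_representation)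
    then show ?thesis by (simp add: w_def euclidean_representation)
  qed
  have "continuous_on ({0..1} - S) w"
  proof (subst continuous_on_cong[OF refl w])
    have "continuous_on ({0..1} - S) (\<lambda>t. frechet_derivative f (at (\<gamma> t)) b)" for b
      by (rule continuous_on_compose2[OF fc continuous_on_subset[OF cont]]) (use inD in auto)
    moreover have "continuous_on ({0..1} - S) v"
      using S(2) by (simp add: v_def C1_differentiable_on_eq)
    ultimately show "continuous_on ({0..1} - S) (\<lambda>t. \<Sum>b\<in>Basis. (v t \<bullet> b) *\<^sub>R frechet_derivative f (at (\<gamma> t)) b)"
      by (intro continuous_intros)
  qed auto
  then have "(f \<circ> \<gamma>) C1_differentiable_on ({0..1} - S)"
    unfolding C1_differentiable_on_def using der by blast
  moreover have "continuous_on (D_space e) f"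
    using fd by (meson continuous_at_imp_continuous_on differentiable_imp_continuous_within)
  then have "continuous_on (\<gamma> ` {0..1}) f"
    by (rule continuous_on_subset) (use inD in auto)
  then have "continuous_on {0..1} (f \<circ> \<gamma>)"
    by (rule continuous_on_compose[OF cont])
  ultimately have "valid_path (f \<circ> \<gamma>)"
    using S(1) by (auto simp: valid_path_def piecewise_C1_differentiable_on_def)
  moreover have "has_D_length e (f \<circ> \<gamma>) L"
    unfolding has_D_length_def
  proof (rule has_integral_spike_finite[OF S(1)])
    show "((\<lambda>t. sqrt (D_metric e (\<gamma> t) (v t) (v t))) has_integral L) {0..1}"
      using \<gamma>(5) by (simp add: has_D_length_def v_def)
    fix t :: real assume t: "t \<in> {0..1} - S"
    have "vector_derivative (f \<circ> \<gamma>) (at t) = w t" using der[OF t] by (rule vector_derivative_at)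
    then show "sqrt (D_metric e ((f \<circ> \<gamma>) t) (vector_derivative (f \<circ> \<gamma>) (at t)) (vector_derivative (f \<circ> \<gamma>) (at t)))
         = sqrt (D_metric e (\<gamma> t) (v t) (v t))"
      using fm[OF inD] t by (simp add: w_def)
  qed
  moreover have "path_image (f \<circ> \<gamma>) \<subseteq> D_space e"
    using inD fD by (auto simp: path_image_def)
  ultimately show ?thesis
    unfolding path_lengths_def using \<gamma>(3,4)
    by (auto intro!: exI[of _ "f \<circ> \<gamma>"] simp: pathstart_def pathfinish_def)
qed

lemma metric_preserving_D_dist_le:
  assumes "metric_preserving f" "x \<in> D_space e" "y \<in> D_space e"
  shows "D_dist e (f x) (f y) \<le> D_dist e x y"
  unfolding D_dist_eq_Inf
proof (rule cInf_superset_mono[OF path_lengths_nonempty[OF assms(2,3)]])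
  have "0 \<in> C_prime e" by (simp add: C_prime_iff)
  from calibration_le_path_length[OF vertical_calibrated_line[OF this]]
  show "bdd_below (path_lengths (f x) (f y))"
    by (intro bdd_belowI[of _ 0]) (meson abs_ge_zero order_trans)
qed (use metric_preserving_path_lengths[OF assms(1)] in auto)

lemma isometry_bij: "g \<in> D_isometries e \<Longrightarrow> bij_betw g (D_space e) (D_space e)"
  by (simp add: D_isometries_def Bij_def)

lemma isometry_metric_preserving:
  assumes "g \<in> D_isometries e"
  shows "metric_preserving g"
proof -
  have "Ck_on 1 g (D_space e)"
    using assms by (auto simp: D_isometries_def smooth_map_on_def)
  then show ?thesis
    using assms isometry_bij[OF assms] by (simp add: D_isometries_def metric_preserving_def bij_betw_imp_surj_on)
qed

lemma isometry_inverse: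
  assumes g: "g \<in> D_isometries e"
  shows "restrict (inv_into (D_space e) g) (D_space e) \<in> D_isometries e" (is "?k \<in> _")
proof -
  let ?D = "D_space e"
  have bij: "bij_betw g ?D ?D" using g by (rule isometry_bij)
  have gk: "g (?k z) = z" "?k z \<in> ?D" and kg: "?k (g z) = z" "g z \<in> ?D" if "z \<in> ?D" for z
    using bij_betw_inv_into_right[OF bij that] bij_betw_inv_into_left[OF bij that]
      bij_betw_apply[OF bij that] bij_betw_apply[OF bij_betw_inv_into[OF bij] that] that by auto
  have Bij: "?k \<in> Bij ?D" using g by (simp add: D_isometries_def restrict_inv_into_Bij)
  have smooth_k: "smooth_map_on ?D ?k"
    unfolding smooth_map_on_def
  proof (rule allI, rule Ck_on_cong[OF open_D])
    show "Ck_on k (inv_into ?D g) ?D" for k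
      using g by (simp add: D_isometries_def smooth_map_on_def)
  qed auto
  have bijk: "bij_betw ?k ?D ?D" using Bij by (simp add: Bij_def)
  have "inv_into ?D ?k z = g z" if "z \<in> ?D" for z
    using bijk kg[OF that] by (metis bij_betw_inv_into_left)
  moreover have "smooth_map_on ?D g" using g by (simp add: D_isometries_def)
  ultimately have smooth_ik: "smooth_map_on ?D (inv_into ?D ?k)"
    unfolding smooth_map_on_def using Ck_on_cong[OF open_D] by metis
  have "D_metric e (?k \<zeta>) (frechet_derivative ?k (at \<zeta>) u) (frechet_derivative ?k (at \<zeta>) v) = D_metric e \<zeta> u v"
    if z: "\<zeta> \<in> ?D" for \<zeta> u v
  proof -
    have "Ck_on 1 ?k ?D" "Ck_on 1 g ?D"
      using smooth_k g by (simp_all only: smooth_map_on_def D_isometries_def mem_Collect_eq)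
    then have "?k differentiable (at \<zeta>)" "g differentiable (at (?k \<zeta>))"
      using z gk by simp_all
    then have "((g \<circ> ?k) has_derivative frechet_derivative g (at (?k \<zeta>)) \<circ> frechet_derivative ?k (at \<zeta>)) (at \<zeta>)"
      by (intro diff_chain_at) (simp_all add: frechet_derivative_works)
    then have "((\<lambda>z. z) has_derivative frechet_derivative g (at (?k \<zeta>)) \<circ> frechet_derivative ?k (at \<zeta>)) (at \<zeta>)"
      by (rule has_derivative_transform_within_open[OF _ open_D z]) (use gk in auto)
    then have "frechet_derivative g (at (?k \<zeta>)) \<circ> frechet_derivative ?k (at \<zeta>) = (\<lambda>v. v)"
      using has_derivative_unique[OF _ has_derivative_ident] by blast
    then have id: "frechet_derivative g (at (?k \<zeta>)) (frechet_derivative ?k (at \<zeta>) v) = v" for v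
      by (simp add: fun_eq_iff)
    have "D_metric e (g (?k \<zeta>)) (frechet_derivative g (at (?k \<zeta>)) u') (frechet_derivative g (at (?k \<zeta>)) v')
        = D_metric e (?k \<zeta>) u' v'" for u' v'
      using g gk(2)[OF z] unfolding D_isometries_def by blast
    from this[of "frechet_derivative ?k (at \<zeta>) u" "frechet_derivative ?k (at \<zeta>) v"]
    show ?thesis unfolding id gk(1)[OF z] by simp
  qed
  then show ?thesis
    using Bij smooth_k smooth_ik by (simp add: D_isometries_def)
qed

lemma isometry_D_dist:
  assumes g: "g \<in> D_isometries e" and "x \<in> D_space e" "y \<in> D_space e"
  shows "D_dist e (g x) (g y) = D_dist e x y"
proof (rule antisym)
  show "D_dist e (g x) (g y) \<le> D_dist e x y"
    using metric_preserving_D_dist_le[OF isometry_metric_preserving] assms by blast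
  let ?k = "restrict (inv_into (D_space e) g) (D_space e)"
  have "g x \<in> D_space e" "g y \<in> D_space e" "?k (g x) = x" "?k (g y) = y"
    using isometry_bij[OF g] assms(2,3)
    by (simp_all add: bij_betw_apply bij_betw_inv_into_left)
  then show "D_dist e x y \<le> D_dist e (g x) (g y)"
    using metric_preserving_D_dist_le[OF isometry_metric_preserving[OF isometry_inverse[OF g]], of "g x" "g y"]
    by simp
qed

lemma isometry_chord:
  assumes "g \<in> D_isometries e" "x \<in> D_space e" "y \<in> D_space e"
  shows "chord e (g x) (g y) = chord e x y"
proof -
  have "g x \<in> D_space e" "g y \<in> D_space e"
    using isometry_bij[OF assms(1)] assms(2,3) by (simp_all add: bij_betw_apply)
  then show ?thesis using cosh_D_dist(2) isometry_D_dist assms by simp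
qed

text \<open>
  The inverse in \<open>G_group\<close> is a definite description over the carrier. As the carrier is contained in
  the group of all bijections of \<open>D\<close>, where inverses are unique, and contains the inverse bijection by
  \<open>isometry_inverse\<close>, the two inverses coincide.
\<close>

lemma inv_G_group:
  assumes g: "g \<in> D_isometries e"
  shows "inv\<^bsub>G_group e\<^esub> g = restrict (inv_into (D_space e) g) (D_space e)"
proof -
  let ?k = "restrict (inv_into (D_space e) g) (D_space e)"
  let ?B = "BijGroup (D_space e)"
  interpret B: group ?B by (rule group_BijGroup)
  have gB: "g \<in> carrier ?B" using g by (simp add: BijGroup_def D_isometries_def)
  have k: "?k = inv\<^bsub>?B\<^esub> g"
    using g by (simp add: inv_BijGroup D_isometries_def)
  have kI: "?k \<in> D_isometries e" using g by (rule isometry_inverse)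
  have sub: "D_isometries e \<subseteq> carrier ?B" by (auto simp: BijGroup_def D_isometries_def)
  have "(THE y. y \<in> D_isometries e \<and> g \<otimes>\<^bsub>?B\<^esub> y = \<one>\<^bsub>?B\<^esub> \<and> y \<otimes>\<^bsub>?B\<^esub> g = \<one>\<^bsub>?B\<^esub>) = ?k"
  proof (rule the_equality)
    show "?k \<in> D_isometries e \<and> g \<otimes>\<^bsub>?B\<^esub> ?k = \<one>\<^bsub>?B\<^esub> \<and> ?k \<otimes>\<^bsub>?B\<^esub> g = \<one>\<^bsub>?B\<^esub>"
      using kI gB by (simp add: k)
    show "y = ?k" if "y \<in> D_isometries e \<and> g \<otimes>\<^bsub>?B\<^esub> y = \<one>\<^bsub>?B\<^esub> \<and> y \<otimes>\<^bsub>?B\<^esub> g = \<one>\<^bsub>?B\<^esub>" for y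
      using B.inv_equality[of y g] that gB sub unfolding k by blast
  qed
  then show ?thesis
    by (simp add: m_inv_def G_group_def)
qed

section \<open>Normal forms of isometries\<close>

lemma M_maps_linear: "\<phi> \<in> M_maps e \<Longrightarrow> linear \<phi>"
  by (simp add: M_maps_def orthogonal_transformation_linear)

lemma M_maps_norm: "\<phi> \<in> M_maps e \<Longrightarrow> norm (\<phi> z) = norm z"
  by (simp add: M_maps_def orthogonal_transformation_norm)

lemma M_maps_Re_part: "\<phi> \<in> M_maps e \<Longrightarrow> Re_part e (\<phi> z) = Re_part e z"
  unfolding M_maps_def Re_part_def orthogonal_transformation_def by (metis (mono_tags, lifting) mem_Collect_eq)

lemma conj_map_eq: "conj_map e z = (2 * Re_part e z) *\<^sub>R e - z"
  by (simp add: conj_map_def Im_part_def scaleR_2[symmetric] algebra_simps)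

lemma linear_conj_map: "linear (conj_map e)"
  by (rule linearI) (simp_all add: conj_map_eq algebra_simps)

lemma norm_conj_map: "norm (conj_map e z) = norm z"
proof -
  have "(norm (conj_map e z))\<^sup>2 = (norm z)\<^sup>2"
    using norm_scaled_diff_square[of "2 * Re_part e z" e 1 z] norm_e
    by (simp add: conj_map_eq power2_eq_square Re_part_def inner_commute)
  then show ?thesis by simp
qed

lemma C_inverse_0 [simp]: "C_inverse e 0 = 0"
  by (simp add: C_inverse_def)

lemma norm_C_inverse: "norm (C_inverse e z) = 1 / norm z"
  by (simp add: C_inverse_def norm_conj_map power2_eq_square)

lemma Re_part_C_inverse: "Re_part e (C_inverse e z) = Re_part e z / (norm z)\<^sup>2"
  by (simp add: C_inverse_def conj_map_eq)

lemma D_nonzero: "z \<in> D_space e \<Longrightarrow> z \<noteq> 0"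
  by (auto simp: D_space_def)

lemma C_inverse_D: "z \<in> D_space e \<Longrightarrow> C_inverse e z \<in> D_space e"
  using D_nonzero[of z] by (simp add: D_space_def Re_part_C_inverse)

lemma C_inverse_involution: "C_inverse e (C_inverse e z) = z"
proof (cases "z = 0")
  case False
  then show ?thesis
    by (simp add: C_inverse_def[of e "C_inverse e z"] norm_C_inverse conj_map_eq[of "C_inverse e z"]
        Re_part_C_inverse)
       (simp add: C_inverse_def conj_map_eq algebra_simps power2_eq_square)
qed simp

lemma C_inverse_scaleR: "C_inverse e (t *\<^sub>R z) = (1 / t) *\<^sub>R C_inverse e z"
  by (simp add: C_inverse_def conj_map_eq power_mult_distrib algebra_simps) (simp add: power2_eq_square)

lemma C_inverse_M_maps:
  assumes "\<phi> \<in> M_maps e"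
  shows "C_inverse e (\<phi> z) = \<phi> (C_inverse e z)"
proof -
  have "\<phi> e = e" using assms by (simp add: M_maps_def)
  then show ?thesis
    using M_maps_linear[OF assms]
    by (simp add: C_inverse_def conj_map_eq M_maps_norm[OF assms] M_maps_Re_part[OF assms]
        linear_diff linear_scale)
qed

text \<open>
  The geodesic inversion is an isometry: it divides heights by \<open>|x|\<^sup>2\<close> and \<open>|y|\<^sup>2\<close> and the Euclidean
  distance by \<open>|x| |y|\<close>.
\<close>

lemma chord_C_inverse:
  assumes "x \<in> D_space e" "y \<in> D_space e"
  shows "chord e (C_inverse e x) (C_inverse e y) = chord e x y"
proof -
  have n: "norm x > 0" "norm y > 0" using assms[THEN D_nonzero] by simp_all
  have "C_inverse e x - C_inverse e y = conj_map e ((1 / (norm x)\<^sup>2) *\<^sub>R x - (1 / (norm y)\<^sup>2) *\<^sub>R y)"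
    using linear_conj_map by (simp add: C_inverse_def linear_diff linear_scale)
  then have "(norm (C_inverse e x - C_inverse e y))\<^sup>2 =
      (1 / (norm x)\<^sup>2)\<^sup>2 * (norm x)\<^sup>2 - 2 * (1 / (norm x)\<^sup>2) * (1 / (norm y)\<^sup>2) * inner x y + (1 / (norm y)\<^sup>2)\<^sup>2 * (norm y)\<^sup>2"
    by (simp only: norm_conj_map norm_scaled_diff_square)
  also have "\<dots> = (norm (x - y))\<^sup>2 / ((norm x)\<^sup>2 * (norm y)\<^sup>2)"
    using n norm_scaled_diff_square[of 1 x 1 y] by (simp add: field_simps power2_eq_square)
  finally show ?thesis
    using n by (simp add: chord_def Re_part_C_inverse)
qed

text \<open>
  If heights scale by \<open>\<kappa>\<close>, preservation of \<open>chord\<close> says that Euclidean distances scale by \<open>\<kappa>\<close>. A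
  Euclidean isometry defined on a half-space is affine: its linear part is determined on the unit
  sphere about an interior point, here \<open>2 e\<close>, and elsewhere by inner products with the vectors of
  that sphere. It fixes \<open>e\<close> because it preserves heights.
\<close>

lemma height_scaling_imp_similarity:
  assumes k: "\<And>x. x \<in> D_space e \<Longrightarrow> k x \<in> D_space e"
    and chord: "\<And>x y. x \<in> D_space e \<Longrightarrow> y \<in> D_space e \<Longrightarrow> chord e (k x) (k y) = chord e x y"
    and lam: "\<kappa> > 0" "\<And>x. x \<in> D_space e \<Longrightarrow> Re_part e (k x) = \<kappa> * Re_part e x"
  shows "\<exists>\<phi>\<in>M_maps e. \<exists>Z\<in>C_prime e. \<forall>x\<in>D_space e. k x = \<kappa> *\<^sub>R \<phi> x + Z"
proof -
  have dist: "norm (k x - k y) = \<kappa> * norm (x - y)" if xy: "x \<in> D_space e" "y \<in> D_space e" for x y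
  proof -
    have "Re_part e x > 0" "Re_part e y > 0" using xy by (simp_all add: D_space_def)
    then have "(norm (k x - k y))\<^sup>2 = (\<kappa> * norm (x - y))\<^sup>2"
      using chord[OF xy] lam xy by (simp add: chord_def field_simps power2_eq_square)
    then show ?thesis using lam by (simp add: power2_eq_iff_nonneg)
  qed
  define S where "S u = (1 / \<kappa>) *\<^sub>R (k (2 *\<^sub>R e + u) - k (2 *\<^sub>R e))" for u
  \<comment> \<open>The domain of \<open>S\<close>, which is \<open>D\<close> translated so that \<open>2 e\<close> becomes the origin; it contains
    the closed unit ball.\<close>
  define U where "U = {u. Re_part e u > - 2}"
  have UD: "2 *\<^sub>R e + u \<in> D_space e" if "u \<in> U" for u
    using that by (simp add: U_def D_space_def)
  have S0: "S 0 = 0" "0 \<in> U" by (simp_all add: S_def U_def)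
  have Sdist: "norm (S u - S v) = norm (u - v)" if "u \<in> U" "v \<in> U" for u v
  proof -
    have "S u - S v = (1 / \<kappa>) *\<^sub>R (k (2 *\<^sub>R e + u) - k (2 *\<^sub>R e + v))"
      by (simp add: S_def algebra_simps)
    then show ?thesis using dist[OF UD[OF that(1)] UD[OF that(2)]] lam by simp
  qed
  have Snorm: "norm (S u) = norm u" if "u \<in> U" for u
    using Sdist[OF that S0(2)] S0 by simp
  have Sinner: "inner (S u) (S v) = inner u v" if "u \<in> U" "v \<in> U" for u v
    using Sdist[OF that] Snorm[OF that(1)] Snorm[OF that(2)]
      norm_scaled_diff_square[of 1 "S u" 1 "S v"] norm_scaled_diff_square[of 1 u 1 v] by simp
  have sphU: "u \<in> U" if "norm u = 1" for u
    using Re_part_le_norm[of u] that by (simp add: U_def)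
  obtain \<phi> where \<phi>: "orthogonal_transformation \<phi>" "\<And>u. norm u = 1 \<Longrightarrow> \<phi> u = S u"
  proof -
    have "norm (S x) = 1" if "norm x = 1" for x
      using that Snorm sphU by simp
    moreover have "dist (S x) (S y) = dist x y" if "norm x = 1" "norm y = 1" for x y
      using that Sdist sphU by (simp add: dist_norm)
    ultimately show thesis
      using isometry_sphere_extend[of S] that by blast
  qed
  have lin: "linear \<phi>" using \<phi>(1) by (rule orthogonal_transformation_linear)
  have S\<phi>: "S u = \<phi> u" if u: "u \<in> U" for u
  proof (rule ccontr)
    assume "S u \<noteq> \<phi> u"
    then have d: "S u - \<phi> u \<noteq> 0" by simp
    obtain w where w: "\<phi> w = S u - \<phi> u"
      using orthogonal_transformation_surj[OF \<phi>(1)] by (metis surjD)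
    with d have "w \<noteq> 0" using lin by (auto simp: linear_0)
    define w' where "w' = (1 / norm w) *\<^sub>R w"
    have w': "norm w' = 1" using \<open>w \<noteq> 0\<close> by (simp add: w'_def)
    have "inner (S u) (\<phi> w') = inner (\<phi> u) (\<phi> w')"
      using Sinner[OF u sphU[OF w']] \<phi>(1) unfolding \<phi>(2)[OF w', symmetric]
      by (simp add: orthogonal_transformation_def)
    then have "inner (S u - \<phi> u) (\<phi> w) = 0"
      using \<open>w \<noteq> 0\<close> lin by (simp add: inner_diff_left w'_def linear_scale)
    then show False using d w by simp
  qed
  have Re: "Re_part e (S u) = Re_part e u" if "u \<in> U" for u
    using lam(2)[OF UD[OF that]] lam(2)[OF UD[OF S0(2)]] lam(1) by (simp add: S_def algebra_simps)
  have "(norm (\<phi> e - e))\<^sup>2 = 0"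
    using Re[OF sphU[OF norm_e]] S\<phi>[OF sphU[OF norm_e]] Snorm[OF sphU[OF norm_e]] norm_e
      norm_scaled_diff_square[of 1 "\<phi> e" 1 e] by (simp add: Re_part_def)
  then have \<phi>e: "\<phi> e = e" by simp
  define Z where "Z = k (2 *\<^sub>R e) - (2 * \<kappa>) *\<^sub>R e"
  have "Z \<in> C_prime e"
    using lam(2)[of "2 *\<^sub>R e"] by (simp add: Z_def C_prime_iff D_space_def)
  moreover have "k x = \<kappa> *\<^sub>R \<phi> x + Z" if x: "x \<in> D_space e" for x
  proof -
    have "x - 2 *\<^sub>R e \<in> U" using x by (simp add: U_def D_space_def)
    then have "\<phi> (x - 2 *\<^sub>R e) = (1 / \<kappa>) *\<^sub>R (k x - k (2 *\<^sub>R e))"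
      using S\<phi>[of "x - 2 *\<^sub>R e"] by (simp add: S_def)
    then have "\<kappa> *\<^sub>R (\<phi> x - 2 *\<^sub>R e) = k x - k (2 *\<^sub>R e)"
      using lam lin by (simp add: linear_diff linear_scale \<phi>e)
    then show ?thesis by (simp add: Z_def algebra_simps)
  qed
  ultimately show ?thesis using \<phi>(1) \<phi>e by (auto simp: M_maps_def)
qed

text \<open>
  Up to the factor \<open>Re x\<close>, the left side is the exponential of a Busemann function based at
  \<open>g\<^sup>-\<^sup>1\<infinity>\<close>, and it is computed as such. With \<open>s\<^sub>n = n + 1\<close> and \<open>p\<^sub>n = g\<^sup>-\<^sup>1(s\<^sub>n e)\<close>, invariance of
  \<open>chord\<close> gives \<open>|x - p\<^sub>n|\<^sup>2 / (s\<^sub>n Re p\<^sub>n) \<rightarrow> Re x / Re (g x)\<close>. For each \<open>n\<close> the expression on the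
  left is a quadratic polynomial in \<open>x\<close> with the coefficients \<open>b\<^sub>n = 1 / (s\<^sub>n Re p\<^sub>n)\<close>,
  \<open>q\<^sub>n = b\<^sub>n p\<^sub>n\<close> and \<open>c\<^sub>n = b\<^sub>n |p\<^sub>n|\<^sup>2\<close>. Convergence at all points of the open set \<open>D\<close> forces the
  coefficients to converge, and the relations \<open>c\<^sub>n b\<^sub>n = |q\<^sub>n|\<^sup>2\<close> and \<open>q\<^sub>n \<bullet> e = 1 / s\<^sub>n\<close> pass to the
  limit.
\<close>

lemma height_ratio_quadratic:
  assumes bij: "bij_betw g (D_space e) (D_space e)"
    and chord: "\<And>x y. x \<in> D_space e \<Longrightarrow> y \<in> D_space e \<Longrightarrow> chord e (g x) (g y) = chord e x y"
  obtains \<beta> w \<alpha> where "\<beta> \<ge> 0" "w \<in> C_prime e" "\<alpha> * \<beta> = (norm w)\<^sup>2"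
    "\<And>x. x \<in> D_space e \<Longrightarrow> Re_part e x / Re_part e (g x) = \<beta> * (norm x)\<^sup>2 - 2 * inner w x + \<alpha>"
proof -
  define f where "f x = Re_part e x / Re_part e (g x)" for x
  define s where "s n = real (Suc n)" for n
  have s: "s n > 0" for n by (simp add: s_def)
  have slim: "(\<lambda>n. 1 / s n) \<longlonglongrightarrow> 0"
    using LIMSEQ_inverse_real_of_nat by (simp add: s_def inverse_eq_divide)
  define p where "p n = inv_into (D_space e) g (s n *\<^sub>R e)" for n
  have sD: "s n *\<^sub>R e \<in> D_space e" for n using s by (simp add: D_space_def)
  have pD: "p n \<in> D_space e" and gp: "g (p n) = s n *\<^sub>R e" for n
    unfolding p_def using bij_betw_apply[OF bij_betw_inv_into[OF bij] sD] bij_betw_inv_into_right[OF bij sD]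
    by auto
  define b where "b n = 1 / (s n * Re_part e (p n))" for n
  have b0: "b n > 0" for n using s pD[of n] by (simp add: b_def D_space_def)
  define q where "q n = b n *\<^sub>R p n" for n
  define c where "c n = b n * (norm (p n))\<^sup>2" for n
  define F where "F n x = b n * (norm x)\<^sup>2 - 2 * inner (q n) x + c n" for n x
  have F: "F n x = b n * (norm (x - p n))\<^sup>2" for n x
  proof -
    have "(norm (x - p n))\<^sup>2 = (norm x)\<^sup>2 - 2 * inner x (p n) + (norm (p n))\<^sup>2"
      using norm_scaled_diff_square[of 1 x 1 "p n"] by simp
    then show ?thesis
      by (simp only: F_def q_def c_def) (simp add: algebra_simps inner_commute)
  qed
  have Flim: "(\<lambda>n. F n x) \<longlonglongrightarrow> f x" if x: "x \<in> D_space e" for x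
  proof -
    have gx: "g x \<in> D_space e" using bij x by (rule bij_betw_apply)
    have "F n x = f x * (norm ((1 / s n) *\<^sub>R g x - e))\<^sup>2" for n
    proof -
      have "F n x = Re_part e x / s n * chord e x (p n)"
        using x pD[of n] s[of n] by (simp add: F b_def chord_def D_space_def)
      also have "chord e x (p n) = chord e (g x) (s n *\<^sub>R e)"
        using chord[OF x pD[of n]] gp by simp
      also have "\<dots> = (norm (g x - s n *\<^sub>R e))\<^sup>2 / (Re_part e (g x) * s n)"
        by (simp add: chord_def)
      also have "g x - s n *\<^sub>R e = s n *\<^sub>R ((1 / s n) *\<^sub>R g x - e)"
        using s[of n] by (simp add: algebra_simps)
      also have "(norm \<dots>)\<^sup>2 = (s n)\<^sup>2 * (norm ((1 / s n) *\<^sub>R g x - e))\<^sup>2"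
        by (simp only: norm_scaleR power_mult_distrib power2_abs)
      finally show ?thesis
        using s[of n] gx by (simp add: f_def power2_eq_square)
    qed
    moreover have "(\<lambda>n. f x * (norm ((1 / s n) *\<^sub>R g x - e))\<^sup>2) \<longlonglongrightarrow> f x * (norm (0 *\<^sub>R g x - e))\<^sup>2"
      by (intro tendsto_intros slim)
    ultimately show ?thesis using norm_e by simp
  qed
  have qe: "inner (q n) e = 1 / s n" for n
  proof -
    have "inner (p n) e \<noteq> 0" using pD[of n] by (simp add: D_space_def Re_part_def)
    then show ?thesis using s[of n] by (simp add: q_def b_def Re_part_def)
  qed
  have Fe: "F n (t *\<^sub>R e) = b n * t\<^sup>2 - 2 * t / s n + c n" for n t
    using norm_e by (simp add: F_def qe power_mult_distrib)
  have teD: "t *\<^sub>R e \<in> D_space e" if "t > 0" for t using that by (simp add: D_space_def)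
  obtain \<beta> where \<beta>: "b \<longlonglongrightarrow> \<beta>"
  proof
    \<comment> \<open>The combination of values at \<open>e\<close> and \<open>3 e\<close> isolates the quadratic coefficient, since the
      linear term along \<open>e\<close> is known to be \<open>- 2 / s n\<close>.\<close>
    have "b n = (F n (3 *\<^sub>R e) - F n (1 *\<^sub>R e) + 4 * (1 / s n)) / 8" for n
      unfolding Fe by simp
    moreover have "(\<lambda>n. (F n (3 *\<^sub>R e) - F n (1 *\<^sub>R e) + 4 * (1 / s n)) / 8)
        \<longlonglongrightarrow> (f (3 *\<^sub>R e) - f (1 *\<^sub>R e) + 4 * 0) / 8"
      by (intro tendsto_intros Flim slim teD) auto
    ultimately show "b \<longlonglongrightarrow> (f (3 *\<^sub>R e) - f (1 *\<^sub>R e) + 4 * 0) / 8" by presburger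
  qed
  obtain \<alpha> where \<alpha>: "c \<longlonglongrightarrow> \<alpha>"
  proof
    have "c n = F n (1 *\<^sub>R e) - b n + 2 * (1 / s n)" for n
      unfolding Fe by simp
    moreover have "(\<lambda>n. F n (1 *\<^sub>R e) - b n + 2 * (1 / s n)) \<longlonglongrightarrow> f (1 *\<^sub>R e) - \<beta> + 2 * 0"
      by (intro tendsto_intros Flim slim teD \<beta>) auto
    ultimately show "c \<longlonglongrightarrow> f (1 *\<^sub>R e) - \<beta> + 2 * 0" by presburger
  qed
  have "\<exists>l. (\<lambda>n. inner (q n) i) \<longlonglongrightarrow> l" if i: "i \<in> Basis" for i
  proof
    have "2 *\<^sub>R e + i \<in> D_space e"
      using Re_part_le_norm[of i] i by (simp add: D_space_def)
    from Flim[OF this]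
    have "(\<lambda>n. (b n * (norm (2 *\<^sub>R e + i))\<^sup>2 + c n - F n (2 *\<^sub>R e + i)) / 2 - 2 * (1 / s n))
        \<longlonglongrightarrow> (\<beta> * (norm (2 *\<^sub>R e + i))\<^sup>2 + \<alpha> - f (2 *\<^sub>R e + i)) / 2 - 2 * 0"
      by (intro tendsto_intros slim \<alpha> \<beta>) auto
    moreover have "inner (q n) i = (b n * (norm (2 *\<^sub>R e + i))\<^sup>2 + c n - F n (2 *\<^sub>R e + i)) / 2 - 2 * (1 / s n)" for n
      by (simp add: F_def inner_add_right qe algebra_simps)
    ultimately show "(\<lambda>n. inner (q n) i) \<longlonglongrightarrow> (\<beta> * (norm (2 *\<^sub>R e + i))\<^sup>2 + \<alpha> - f (2 *\<^sub>R e + i)) / 2 - 2 * 0"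
      by presburger
  qed
  then obtain l where l: "\<And>i. i \<in> Basis \<Longrightarrow> (\<lambda>n. inner (q n) i) \<longlonglongrightarrow> l i" by metis
  define w where "w = (\<Sum>i\<in>Basis. l i *\<^sub>R i)"
  have "(\<lambda>n. \<Sum>i\<in>Basis. inner (q n) i *\<^sub>R i) \<longlonglongrightarrow> w"
    unfolding w_def by (intro tendsto_intros l)
  then have w: "q \<longlonglongrightarrow> w" by (simp add: euclidean_representation)
  show thesis
  proof
    show "\<beta> \<ge> 0"
      using \<beta> b0 by (meson LIMSEQ_le_const less_imp_le)
    have "(\<lambda>n. inner (q n) e) \<longlonglongrightarrow> inner w e" by (intro tendsto_intros w)
    then show "w \<in> C_prime e"
      using slim LIMSEQ_unique unfolding qe by (auto simp: C_prime_iff Re_part_def)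
    have "(\<lambda>n. c n * b n) \<longlonglongrightarrow> \<alpha> * \<beta>" by (intro tendsto_intros \<alpha> \<beta>)
    moreover have "c n * b n = (norm (q n))\<^sup>2" for n
      by (simp add: c_def q_def power_mult_distrib) (simp add: power2_eq_square)
    moreover have "(\<lambda>n. (norm (q n))\<^sup>2) \<longlonglongrightarrow> (norm w)\<^sup>2" by (intro tendsto_intros w)
    ultimately show "\<alpha> * \<beta> = (norm w)\<^sup>2" using LIMSEQ_unique by auto
    show "Re_part e x / Re_part e (g x) = \<beta> * (norm x)\<^sup>2 - 2 * inner w x + \<alpha>" if "x \<in> D_space e" for x
    proof (rule LIMSEQ_unique)
      show "(\<lambda>n. F n x) \<longlonglongrightarrow> Re_part e x / Re_part e (g x)"
        using Flim[OF that] by (simp add: f_def)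
      show "(\<lambda>n. F n x) \<longlonglongrightarrow> \<beta> * (norm x)\<^sup>2 - 2 * inner w x + \<alpha>"
        unfolding F_def by (intro tendsto_intros \<alpha> \<beta> w)
    qed
  qed
qed

definition similarity_form :: "('a \<Rightarrow> 'a) \<Rightarrow> real \<Rightarrow> ('a \<Rightarrow> 'a) \<Rightarrow> 'a \<Rightarrow> bool" where
  "similarity_form g \<kappa> \<phi> Z \<longleftrightarrow> \<kappa> > 0 \<and> \<phi> \<in> M_maps e \<and> Z \<in> C_prime e \<and>
     (\<forall>x\<in>D_space e. g x = \<kappa> *\<^sub>R \<phi> x + Z)"

definition inversion_form :: "('a \<Rightarrow> 'a) \<Rightarrow> 'a \<Rightarrow> ('a \<Rightarrow> 'a) \<Rightarrow> real \<Rightarrow> 'a \<Rightarrow> bool" where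
  "inversion_form g Z1 \<phi> t Z2 \<longleftrightarrow> t > 0 \<and> Z1 \<in> C_prime e \<and> \<phi> \<in> M_maps e \<and> Z2 \<in> C_prime e \<and>
     (\<forall>x\<in>D_space e. g x = (n_map Z1 \<circ> C_inverse e \<circ> \<phi> \<circ> a_map t \<circ> n_map Z2) x)"

text \<open>
  If \<open>\<beta> = 0\<close> in \<open>height_ratio_quadratic\<close>, then \<open>w = 0\<close> and heights scale by a constant. If
  \<open>\<beta> > 0\<close>, the polynomial is \<open>\<beta> |x - c|\<^sup>2\<close> with \<open>c = w / \<beta>\<close> on the boundary, so \<open>c\<close> is the point
  sent to \<open>\<infinity>\<close>; inverting at \<open>c\<close> first yields a map that scales heights by \<open>1 / \<beta>\<close>.
\<close>

lemma chord_preserving_cases: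
  assumes bij: "bij_betw g (D_space e) (D_space e)"
    and chord: "\<And>x y. x \<in> D_space e \<Longrightarrow> y \<in> D_space e \<Longrightarrow> chord e (g x) (g y) = chord e x y"
  shows "(\<exists>\<kappa> \<phi> Z. similarity_form g \<kappa> \<phi> Z) \<or> (\<exists>Z1 \<phi> t Z2. inversion_form g Z1 \<phi> t Z2)"
proof -
  obtain \<beta> w \<alpha> where q: "\<beta> \<ge> 0" "w \<in> C_prime e" "\<alpha> * \<beta> = (norm w)\<^sup>2"
    "\<And>x. x \<in> D_space e \<Longrightarrow> Re_part e x / Re_part e (g x) = \<beta> * (norm x)\<^sup>2 - 2 * inner w x + \<alpha>"
    using height_ratio_quadratic[OF bij chord] by blast
  have gD: "g x \<in> D_space e" if "x \<in> D_space e" for x using bij that by (rule bij_betw_apply)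
  have eD: "e \<in> D_space e" by (simp add: D_space_def)
  have pos: "Re_part e x > 0" if "x \<in> D_space e" for x using that by (simp add: D_space_def)
  show ?thesis
  proof (cases "\<beta> = 0")
    case True
    then have "w = 0" using q(3) by simp
    then have r: "Re_part e x / Re_part e (g x) = \<alpha>" if "x \<in> D_space e" for x
      using q(4)[OF that] True by simp
    have \<alpha>: "\<alpha> > 0" using r[OF eD] pos[OF gD[OF eD]] by auto
    have "Re_part e (g x) = (1 / \<alpha>) * Re_part e x" if "x \<in> D_space e" for x
      using r[OF that] pos[OF gD[OF that]] \<alpha> by (simp add: field_simps)
    then have "\<exists>\<phi>\<in>M_maps e. \<exists>Z\<in>C_prime e. \<forall>x\<in>D_space e. g x = (1 / \<alpha>) *\<^sub>R \<phi> x + Z"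
      using \<alpha> by (intro height_scaling_imp_similarity gD chord) auto
    then show ?thesis using \<alpha> unfolding similarity_form_def by (metis divide_pos_pos zero_less_one)
  next
    case False
    then have \<beta>: "\<beta> > 0" using q(1) by simp
    define c where "c = (1 / \<beta>) *\<^sub>R w"
    have c: "c \<in> C_prime e" "Re_part e c = 0" using q(2) by (simp_all add: c_def C_prime_iff)
    have "\<beta> * (norm x)\<^sup>2 - 2 * inner w x + \<alpha> = \<beta> * (norm (x - c))\<^sup>2" for x
    proof -
      have "(norm (x - c))\<^sup>2 = (norm x)\<^sup>2 - 2 * inner w x / \<beta> + (norm w)\<^sup>2 / \<beta>\<^sup>2"
        using norm_scaled_diff_square[of 1 x "1 / \<beta>" w]
        by (simp add: c_def inner_commute power_divide)
      then have "\<beta> * (norm (x - c))\<^sup>2 = \<beta> * (norm x)\<^sup>2 - \<beta> * (2 * inner w x / \<beta>) + \<beta> * (\<alpha> * \<beta> / \<beta>\<^sup>2)"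
        by (simp only: q(3) distrib_left right_diff_distrib)
      then show ?thesis using \<beta> by (simp add: power2_eq_square)
    qed
    then have r: "Re_part e (g x) = Re_part e x / (\<beta> * (norm (x - c))\<^sup>2)" if "x \<in> D_space e" for x
      using q(4)[OF that] pos[OF gD[OF that]] pos[OF that]
      by (metis divide_divide_eq_right less_numeral_extra(3) nonzero_mult_div_cancel_left times_divide_eq_left)
    define h where "h y = g (C_inverse e y + c)" for y
    have trans: "C_inverse e y + c \<in> D_space e" if "y \<in> D_space e" for y
      using C_inverse_D[OF that] by (simp add: D_space_def c)
    have "Re_part e (h y) = (1 / \<beta>) * Re_part e y" if y: "y \<in> D_space e" for y
      using r[OF trans[OF y]] D_nonzero[OF y] \<beta>
      by (simp add: h_def c Re_part_C_inverse norm_C_inverse power_divide)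
    moreover have "chord e (h x) (h y) = chord e x y" if "x \<in> D_space e" "y \<in> D_space e" for x y
    proof -
      have "chord e (h x) (h y) = chord e (C_inverse e x + c) (C_inverse e y + c)"
        unfolding h_def using that by (intro chord trans)
      also have "\<dots> = chord e (C_inverse e x) (C_inverse e y)" by (simp add: chord_def c)
      finally show ?thesis using chord_C_inverse that by simp
    qed
    ultimately have "\<exists>\<phi>\<in>M_maps e. \<exists>Z\<in>C_prime e. \<forall>x\<in>D_space e. h x = (1 / \<beta>) *\<^sub>R \<phi> x + Z"
      using \<beta> by (intro height_scaling_imp_similarity) (auto simp: h_def intro: gD trans)
    then obtain \<phi> Z where \<phi>: "\<phi> \<in> M_maps e" and Z: "Z \<in> C_prime e"
      and h: "\<And>x. x \<in> D_space e \<Longrightarrow> h x = (1 / \<beta>) *\<^sub>R \<phi> x + Z" by blast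
    have "inversion_form g Z \<phi> \<beta> (- c)"
      unfolding inversion_form_def
    proof (intro conjI ballI)
      fix x assume x: "x \<in> D_space e"
      then have "x - c \<in> D_space e" by (simp add: D_space_def c)
      then have "h (C_inverse e (x - c)) = (1 / \<beta>) *\<^sub>R \<phi> (C_inverse e (x - c)) + Z"
        by (intro h C_inverse_D)
      then show "g x = (n_map Z \<circ> C_inverse e \<circ> \<phi> \<circ> a_map \<beta> \<circ> n_map (- c)) x"
        using M_maps_linear[OF \<phi>]
        by (simp add: h_def C_inverse_involution n_map_def a_map_def linear_scale C_inverse_scaleR
            C_inverse_M_maps[OF \<phi>])
    qed (use \<beta> Z \<phi> c in \<open>auto simp: C_prime_iff\<close>)
    then show ?thesis by blast
  qed
qed

lemma similarity_form_height:
  assumes "similarity_form g \<kappa> \<phi> Z" "x \<in> D_space e"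
  shows "ht e (g x) = \<kappa> * ht e x"
  using assms by (simp add: similarity_form_def ht_def M_maps_Re_part C_prime_iff)

lemma inversion_form_eq:
  assumes "inversion_form g Z1 \<phi> t Z2" "x \<in> D_space e"
  shows "g x = Z1 + C_inverse e (t *\<^sub>R \<phi> (x + Z2))"
  using assms M_maps_linear[of \<phi>]
  by (simp add: inversion_form_def n_map_def a_map_def linear_scale add.commute)

lemma inversion_form_height:
  assumes "inversion_form g Z1 \<phi> t Z2" "x \<in> D_space e"
  shows "ht e (g x) = ht e x / (t * (norm (x + Z2))\<^sup>2)"
  using assms
  by (simp add: inversion_form_eq ht_def Re_part_C_inverse)
     (simp add: inversion_form_def M_maps_Re_part M_maps_norm C_prime_iff power_mult_distrib power2_eq_square)

end

section \<open>The action at infinity\<close>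

lemma openin_Alexandroff_euclidean:
  fixes U :: "'a::euclidean_space option set"
  shows "openin (Alexandroff_compactification euclidean) U \<longleftrightarrow>
     (\<exists>V. open V \<and> U = Some ` V) \<or> (\<exists>C. compact C \<and> U = insert None (Some ` (- C)))"
  unfolding openin_Alexandroff_compactification
  by (simp add: Compl_eq_Diff_UNIV) (metis compact_imp_closed)

lemma open_finite_part:
  fixes U :: "'a::euclidean_space option set"
  assumes "openin (Alexandroff_compactification euclidean) U"
  shows "open {z. Some z \<in> U}"
proof -
  have "{z. Some z \<in> Some ` V} = V" "{z. Some z \<in> insert None (Some ` V)} = V" for V :: "'a set"
    by auto
  then show ?thesis
    using assms unfolding openin_Alexandroff_euclidean by (auto simp: compact_imp_closed open_Compl)
qed

lemma continuous_map_Alexandroff_iff: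
  fixes f :: "'a::euclidean_space option \<Rightarrow> 'a option"
  shows "continuous_map (Alexandroff_compactification euclidean) (Alexandroff_compactification euclidean) f \<longleftrightarrow>
     (\<forall>U. openin (Alexandroff_compactification euclidean) U \<longrightarrow>
          openin (Alexandroff_compactification euclidean) (f -` U))"
  by (simp add: continuous_map_def UNIV_option_conv[symmetric] vimage_def)

text \<open>
  Preimages of complements of compact sets are of the same kind because the inverse map carries
  compact sets to compact sets.
\<close>

lemma continuous_map_Alexandroff_homeomorphism:
  fixes f :: "'a::euclidean_space \<Rightarrow> 'a"
  assumes f: "continuous_on UNIV f" and g: "continuous_on UNIV g"
    and inv: "\<And>x. f (g x) = x" "\<And>x. g (f x) = x"
  shows "continuous_map (Alexandroff_compactification euclidean) (Alexandroff_compactification euclidean) (map_option f)"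
  unfolding continuous_map_Alexandroff_iff
proof (intro allI impI)
  fix U :: "'a option set"
  assume "openin (Alexandroff_compactification euclidean) U"
  then consider V where "open V" "U = Some ` V" | C where "compact C" "U = insert None (Some ` (- C))"
    unfolding openin_Alexandroff_euclidean by blast
  then show "openin (Alexandroff_compactification euclidean) (map_option f -` U)"
  proof cases
    case 1
    then have "open (f -` V)" using f by (simp add: continuous_on_open_vimage)
    moreover have "map_option f -` U = Some ` (f -` V)"
      using 1 by (auto simp: map_option_case split: option.splits)
    ultimately show ?thesis unfolding openin_Alexandroff_euclidean by blast
  next
    case 2
    then have "compact (g ` C)"
      using g by (meson compact_continuous_image continuous_on_subset subset_UNIV)
    moreover have "map_option f -` U = insert None (Some ` (- (g ` C)))"
    proof -
      have "f x \<in> C \<longleftrightarrow> x \<in> g ` C" for x using inv by (metis imageE imageI)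
      then show ?thesis using 2 by (auto simp: map_option_case split: option.splits)
    qed
    ultimately show ?thesis unfolding openin_Alexandroff_euclidean by blast
  qed
qed

context half_space begin

fun C_inverse_ext :: "'a option \<Rightarrow> 'a option" where
  "C_inverse_ext None = Some 0"
| "C_inverse_ext (Some z) = (if z = 0 then None else Some (C_inverse e z))"

lemma continuous_on_C_inverse: "continuous_on (- {0}) (C_inverse e)"
  unfolding C_inverse_def conj_map_eq[abs_def] Re_part_def by (intro continuous_intros) auto

lemma C_inverse_eq_0_iff: "C_inverse e z = 0 \<longleftrightarrow> z = 0"
  by (metis C_inverse_0 C_inverse_involution)

lemma open_C_inverse_vimage:
  assumes "open V" shows "open (C_inverse e -` V - {0})"
proof -
  have "open (C_inverse e -` V \<inter> (- {0}))"
    using continuous_on_C_inverse assms by (metis continuous_on_open_vimage open_Compl closed_singleton Int_commute)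
  then show ?thesis by (simp add: Diff_eq)
qed

text \<open>
  The finite part \<open>A\<close> of a preimage is open: away from \<open>0\<close> by continuity of the inversion, and at
  \<open>0\<close>, which is sent to \<open>\<infinity>\<close>, because points near \<open>0\<close> have images of large norm. If the preimage
  contains \<open>\<infinity>\<close>, that is, if the open set contains \<open>0\<close>, then points of large norm have images near
  \<open>0\<close>, so the complement of \<open>A\<close> is bounded.
\<close>

lemma continuous_map_C_inverse_ext:
  "continuous_map (Alexandroff_compactification euclidean) (Alexandroff_compactification euclidean) C_inverse_ext"
  unfolding continuous_map_Alexandroff_iff
proof (intro allI impI)
  fix U :: "'a option set"
  assume U: "openin (Alexandroff_compactification euclidean) U"
  define A where "A = {z. C_inverse_ext (Some z) \<in> U}"
  have openA: "open A"
    using U unfolding openin_Alexandroff_euclidean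
  proof (elim disjE exE conjE)
    fix V assume V: "open V" "U = Some ` V"
    then have "A = C_inverse e -` V - {0}" by (auto simp: A_def split: if_splits)
    then show "open A" using open_C_inverse_vimage[OF V(1)] by simp
  next
    fix C assume C: "compact C" "U = insert None (Some ` (- C))"
    then obtain B where B: "B > 0" "\<And>x. x \<in> C \<Longrightarrow> norm x \<le> B"
      using bounded_pos[THEN iffD1, OF compact_imp_bounded[OF C(1)]] by auto
    have "A = ball 0 (1 / B) \<union> (C_inverse e -` (- C) - {0})"
    proof -
      have "C_inverse e z \<notin> C" if "norm z < 1 / B" "z \<noteq> 0" for z
        using B(2)[of "C_inverse e z"] that B(1) by (auto simp: norm_C_inverse field_simps)
      then show ?thesis using C(2) B(1) by (auto simp: A_def split: if_splits)
    qed
    moreover have "open (C_inverse e -` (- C) - {0})"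
      using C(1) by (intro open_C_inverse_vimage) (simp add: compact_imp_closed open_Compl)
    ultimately show "open A" by auto
  qed
  show "openin (Alexandroff_compactification euclidean) (C_inverse_ext -` U)"
  proof (cases "Some 0 \<in> U")
    case False
    have "x \<in> C_inverse_ext -` U \<longleftrightarrow> x \<in> Some ` A" for x
      using False by (cases x) (simp_all add: A_def image_iff)
    then have "C_inverse_ext -` U = Some ` A" by blast
    then show ?thesis using openA unfolding openin_Alexandroff_euclidean by blast
  next
    case True
    have "open {z. Some z \<in> U}"
      using U by (rule open_finite_part)
    then obtain r where r: "r > 0" "ball 0 r \<subseteq> {z. Some z \<in> U}"
      using True unfolding open_contains_ball by blast
    have "- A \<subseteq> cball 0 (1 / r)"
    proof
      fix z assume z: "z \<in> - A"
      show "z \<in> cball 0 (1 / r)"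
      proof (rule ccontr)
        assume "z \<notin> cball 0 (1 / r)"
        then have "norm z > 1 / r" by simp
        moreover from this have "norm z > 0" using r(1) by (meson divide_pos_pos less_trans zero_less_one)
        ultimately have "C_inverse e z \<in> ball 0 r" "z \<noteq> 0"
          using r(1) by (auto simp: norm_C_inverse field_simps)
        then show False using r(2) z by (auto simp: A_def)
      qed
    qed
    then have "bounded (- A)" using bounded_cball bounded_subset by blast
    then have "compact (- A)" using openA by (simp add: compact_eq_bounded_closed closed_Compl)
    moreover have "x \<in> C_inverse_ext -` U \<longleftrightarrow> x \<in> insert None (Some ` (- (- A)))" for x
      using True by (cases x) (simp_all add: A_def image_iff)
    then have "C_inverse_ext -` U = insert None (Some ` (- (- A)))" by blast
    ultimately show ?thesis unfolding openin_Alexandroff_euclidean by blast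
  qed
qed

lemma D_dense_in_D_closure:
  assumes "x \<in> D_closure e"
  shows "x \<in> D_closure_top e closure_of (Some ` D_space e)"
proof -
  have "Some ` D_space e \<subseteq> D_closure e" by (auto simp: D_closure_def D_space_def)
  then have eq: "D_closure e \<inter> Some ` D_space e = Some ` D_space e" by blast
  have "x \<in> Alexandroff_compactification euclidean closure_of (Some ` D_space e)"
    unfolding in_closure_of
  proof (intro conjI allI impI)
    show "x \<in> topspace (Alexandroff_compactification euclidean)"
      by (cases x) auto
    fix T assume T: "x \<in> T \<and> openin (Alexandroff_compactification euclidean) T"
    show "\<exists>y. y \<in> Some ` D_space e \<and> y \<in> T"
    proof (cases x)
      case None
      then obtain C where C: "compact C" "T = insert None (Some ` (- C))"
        using T unfolding openin_Alexandroff_euclidean by auto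
      then obtain B where B: "B > 0" "\<And>x. x \<in> C \<Longrightarrow> norm x \<le> B"
        using bounded_pos[THEN iffD1, OF compact_imp_bounded[OF C(1)]] by auto
      have "(B + 1) *\<^sub>R e \<notin> C" using B(2)[of "(B + 1) *\<^sub>R e"] B(1) norm_e by auto
      moreover have "(B + 1) *\<^sub>R e \<in> D_space e" using B(1) by (simp add: D_space_def)
      ultimately show ?thesis using C(2) by blast
    next
      case (Some z)
      have "open {z. Some z \<in> T}"
        using T by (intro open_finite_part) simp
      then obtain r where r: "r > 0" "ball z r \<subseteq> {z. Some z \<in> T}"
        using T Some unfolding open_contains_ball by blast
      have "z + (r / 2) *\<^sub>R e \<in> ball z r" using r(1) norm_e by (simp add: dist_norm)
      moreover have "z + (r / 2) *\<^sub>R e \<in> D_space e"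
        using assms Some r(1) by (auto simp: D_closure_def D_space_def)
      ultimately show ?thesis using r(2) by blast
    qed
  qed
  then show ?thesis
    unfolding D_closure_top_def closure_of_subtopology eq using assms by simp
qed

lemma topspace_D_closure_top: "topspace (D_closure_top e) = D_closure e"
  by (simp add: D_closure_top_def UNIV_option_conv[symmetric])

text \<open>
  A continuous map of the compactification that extends \<open>g\<close> and preserves the closure of \<open>D\<close> is
  the continuous extension, by density of \<open>D\<close> and the Hausdorff property. This turns the evaluation
  of the definite description into exhibiting one extension.
\<close>

lemma bdry_ext_eq:
  assumes H: "continuous_map (Alexandroff_compactification euclidean) (Alexandroff_compactification euclidean) H"
    and HD: "\<And>x. x \<in> D_closure e \<Longrightarrow> H x \<in> D_closure e"
    and Hg: "\<And>\<zeta>. \<zeta> \<in> D_space e \<Longrightarrow> H (Some \<zeta>) = Some (g \<zeta>)"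
    and x: "x \<in> D_closure e"
  shows "bdry_ext e g x = H x"
proof -
  let ?P = "\<lambda>h. h \<in> extensional (D_closure e) \<and> continuous_map (D_closure_top e) (D_closure_top e) h \<and>
      (\<forall>\<zeta>\<in>D_space e. h (Some \<zeta>) = Some (g \<zeta>))"
  have sub: "Some \<zeta> \<in> D_closure e" if "\<zeta> \<in> D_space e" for \<zeta>
    using that by (auto simp: D_closure_def D_space_def)
  have P: "?P (restrict H (D_closure e))"
  proof (intro conjI ballI)
    have "continuous_map (D_closure_top e) (D_closure_top e) H"
      unfolding D_closure_top_def
      using HD by (intro continuous_map_into_subtopology continuous_map_from_subtopology[OF H])
        (auto simp: UNIV_option_conv[symmetric])
    then show "continuous_map (D_closure_top e) (D_closure_top e) (restrict H (D_closure e))"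
      by (rule continuous_map_eq) (simp add: topspace_D_closure_top)
  qed (use Hg sub in auto)
  have "bdry_ext e g = restrict H (D_closure e)"
    unfolding bdry_ext_def
  proof (rule the_equality[where P = ?P])
    fix h assume h: "?P h"
    have haus: "Hausdorff_space (D_closure_top e)"
      unfolding D_closure_top_def
      by (intro Hausdorff_space_subtopology)
         (simp add: Hausdorff_space_Alexandroff_compactification locally_compact_space_euclidean)
    show "h = restrict H (D_closure e)"
    proof
      fix y
      show "h y = restrict H (D_closure e) y"
      proof (cases "y \<in> D_closure e")
        case True
        show ?thesis
          using D_dense_in_D_closure[OF True] haus
        proof (rule forall_in_closure_of_eq)
          show "h z = restrict H (D_closure e) z" if "z \<in> Some ` D_space e" for z
            using h P that by auto
        qed (use h P in blast)+
      next
        case False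
        then show ?thesis using h by (simp add: extensional_def)
      qed
    qed
  qed (rule P)
  then show ?thesis using x by simp
qed

lemma None_in_D_closure: "None \<in> D_closure e"
  by (simp add: D_closure_def)

lemma continuous_map_similarity:
  assumes "\<kappa> > 0" "\<phi> \<in> M_maps e"
  shows "continuous_map (Alexandroff_compactification euclidean) (Alexandroff_compactification euclidean)
           (map_option (\<lambda>z. \<kappa> *\<^sub>R \<phi> z + Z))"
proof (rule continuous_map_Alexandroff_homeomorphism)
  have \<phi>: "orthogonal_transformation \<phi>" using assms(2) by (simp add: M_maps_def)
  have lin: "linear \<phi>" "linear (inv_into UNIV \<phi>)"
    using \<phi> orthogonal_transformation_inv orthogonal_transformation_linear by blast+
  show "continuous_on UNIV (\<lambda>z. \<kappa> *\<^sub>R \<phi> z + Z)"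
    by (intro continuous_intros linear_continuous_on linear_conv_bounded_linear[THEN iffD1] lin)
  have "continuous_on UNIV (inv_into UNIV \<phi>)"
    by (intro linear_continuous_on linear_conv_bounded_linear[THEN iffD1] lin)
  then show "continuous_on UNIV (\<lambda>z. inv_into UNIV \<phi> ((1 / \<kappa>) *\<^sub>R (z - Z)))"
    by (rule continuous_on_compose2) (auto intro!: continuous_intros)
  show "\<kappa> *\<^sub>R \<phi> (inv_into UNIV \<phi> ((1 / \<kappa>) *\<^sub>R (x - Z))) + Z = x" for x
    using assms(1) orthogonal_transformation_surj[OF \<phi>] by (simp add: surj_f_inv_f)
  show "inv_into UNIV \<phi> ((1 / \<kappa>) *\<^sub>R (\<kappa> *\<^sub>R \<phi> x + Z - Z)) = x" for x
    using assms(1) orthogonal_transformation_inj[OF \<phi>] by simp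
qed

lemma bdry_ext_similarity_form:
  assumes "similarity_form g \<kappa> \<phi> Z"
  shows "bdry_ext e g None = None"
proof -
  have "bdry_ext e g None = map_option (\<lambda>z. \<kappa> *\<^sub>R \<phi> z + Z) None"
  proof (rule bdry_ext_eq[OF _ _ _ None_in_D_closure])
    show "map_option (\<lambda>z. \<kappa> *\<^sub>R \<phi> z + Z) x \<in> D_closure e" if "x \<in> D_closure e" for x
      using that assms by (auto simp: D_closure_def similarity_form_def M_maps_Re_part C_prime_iff)
  qed (use assms in \<open>auto simp: similarity_form_def intro: continuous_map_similarity\<close>)
  then show ?thesis by simp
qed

text \<open>
  The extension is the composition of two affine maps, which fix \<open>\<infinity>\<close>, with the extended inversion in
  between, which sends \<open>\<infinity>\<close> to \<open>0\<close>. The linear part of the second affine map is the identity, so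
  that \<open>continuous_map_similarity\<close> covers both.
\<close>

lemma bdry_ext_inversion_form:
  assumes g: "inversion_form g Z1 \<phi> t Z2"
  shows "bdry_ext e g None = Some Z1"
proof -
  let ?A = "\<lambda>z. t *\<^sub>R \<phi> z + t *\<^sub>R \<phi> Z2"
  let ?B = "\<lambda>z. 1 *\<^sub>R id z + Z1"
  let ?H = "map_option ?B \<circ> (C_inverse_ext \<circ> map_option ?A)"
  have t: "t > 0" and \<phi>: "\<phi> \<in> M_maps e" and Z: "Re_part e Z1 = 0" "Re_part e Z2 = 0"
    using g by (auto simp: inversion_form_def C_prime_iff)
  have id: "id \<in> M_maps e" by (simp add: M_maps_def orthogonal_transformation_id id_def)
  have A: "?A z = t *\<^sub>R \<phi> (z + Z2)" for z
    using M_maps_linear[OF \<phi>] by (simp add: linear_add scaleR_add_right)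
  have ReA: "Re_part e (?A z) = t * Re_part e z" for z
    using Z by (simp add: M_maps_Re_part[OF \<phi>])
  have "bdry_ext e g None = ?H None"
  proof (rule bdry_ext_eq[OF _ _ _ None_in_D_closure])
    show "continuous_map (Alexandroff_compactification euclidean) (Alexandroff_compactification euclidean) ?H"
      by (rule continuous_map_compose[OF continuous_map_compose[OF continuous_map_similarity[OF t \<phi>]
            continuous_map_C_inverse_ext] continuous_map_similarity[OF zero_less_one id]])
    show "?H x \<in> D_closure e" if "x \<in> D_closure e" for x
    proof (cases x)
      case None
      then show ?thesis using Z by (auto simp: D_closure_def)
    next
      case (Some z)
      then have "Re_part e (?A z) \<ge> 0" using that t unfolding ReA by (auto simp: D_closure_def)
      then have "Re_part e (C_inverse e (?A z)) \<ge> 0" unfolding Re_part_C_inverse by simp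
      then show ?thesis using Some Z(1) by (simp add: D_closure_def)
    qed
    show "?H (Some \<zeta>) = Some (g \<zeta>)" if "\<zeta> \<in> D_space e" for \<zeta>
    proof -
      have "Re_part e (?A \<zeta>) > 0" using that t unfolding ReA by (simp add: D_space_def)
      then have "?A \<zeta> \<noteq> 0" using Re_part_simps(5)[of e] by (metis less_irrefl)
      then show ?thesis
        using inversion_form_eq[OF g that] unfolding A[symmetric] by (simp add: add.commute)
    qed
  qed
  then show ?thesis by simp
qed

section \<open>Isometric spheres and heights\<close>

abbreviation ginv :: "('a \<Rightarrow> 'a) \<Rightarrow> 'a \<Rightarrow> 'a" where
  "ginv g \<equiv> m_inv (G_group e) g"

lemma isometry_cases:
  assumes "g \<in> D_isometries e"
  obtains \<kappa> \<phi> Z where "similarity_form g \<kappa> \<phi> Z"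
    | Z1 \<phi> t Z2 where "inversion_form g Z1 \<phi> t Z2"
  using chord_preserving_cases[OF isometry_bij[OF assms] isometry_chord[OF assms]] by blast

text \<open>
  For isometries this characterises the stabilizer of \<open>\<infinity>\<close> without reference to boundary values
  (\<open>G_inf_iff_scales_height\<close>), in a form that visibly passes to inverses and products.
\<close>

definition scales_height :: "('a \<Rightarrow> 'a) \<Rightarrow> bool" where
  "scales_height g \<longleftrightarrow> (\<exists>\<kappa>. \<forall>x\<in>D_space e. ht e (g x) = \<kappa> * ht e x)"

lemma multiple_of_e_in_D: "s > 0 \<Longrightarrow> s *\<^sub>R e \<in> D_space e"
  by (simp add: D_space_def)

lemma norm_add_C_prime:
  assumes "Z \<in> C_prime e"
  shows "(norm (s *\<^sub>R e + Z))\<^sup>2 = s\<^sup>2 + (norm Z)\<^sup>2"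
  using norm_scaled_diff_square[of s e "- 1" Z] assms norm_e
  by (simp add: C_prime_iff Re_part_def inner_commute)

text \<open>
  Compare \<open>ht (g x) = ht x / (t |x + Z2|\<^sup>2)\<close> at \<open>x = e\<close> and \<open>x = 2 e\<close>.
\<close>

lemma inversion_form_not_scales_height:
  assumes g: "inversion_form g Z1 \<phi> t Z2"
  shows "\<not> scales_height g"
proof
  assume "scales_height g"
  then obtain \<kappa> where k: "\<And>x. x \<in> D_space e \<Longrightarrow> ht e (g x) = \<kappa> * ht e x"
    by (auto simp: scales_height_def)
  have t: "t > 0" and Z2: "Z2 \<in> C_prime e" using g by (auto simp: inversion_form_def)
  have eq: "\<kappa> = 1 / (t * (s\<^sup>2 + (norm Z2)\<^sup>2))" if s: "s > 0" for s
  proof -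
    have "s / (t * (s\<^sup>2 + (norm Z2)\<^sup>2)) = \<kappa> * s"
      using k[OF multiple_of_e_in_D[OF s]] inversion_form_height[OF g multiple_of_e_in_D[OF s]]
      unfolding norm_add_C_prime[OF Z2] by (simp add: ht_def)
    then have "\<kappa> * s = 1 / (t * (s\<^sup>2 + (norm Z2)\<^sup>2)) * s" by (simp only: times_divide_eq_left mult_1_left)
    then show ?thesis by (rule mult_right_cancel[THEN iffD1, rotated]) (use s in simp)
  qed
  have "1 + (norm Z2)\<^sup>2 > 0" by (simp add: add_pos_nonneg)
  moreover have "1 / (t * (1 + (norm Z2)\<^sup>2)) = 1 / (t * (4 + (norm Z2)\<^sup>2))"
    using eq[of 1] eq[of 2] by simp
  ultimately show False using t by (simp add: field_simps)
qed

lemma G_inf_iff_scales_height: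
  assumes "g \<in> D_isometries e"
  shows "g \<in> G_inf e \<longleftrightarrow> scales_height g"
  using assms
proof (cases rule: isometry_cases)
  case 1
  then show ?thesis
    using assms bdry_ext_similarity_form[OF 1] similarity_form_height[OF 1]
    by (auto simp: G_inf_def G_group_def scales_height_def)
next
  case 2
  then show ?thesis
    using bdry_ext_inversion_form[OF 2] inversion_form_not_scales_height[OF 2] by (simp add: G_inf_def)
qed

lemma isometry_inversion_form:
  assumes "g \<in> D_isometries e" "\<not> scales_height g"
  obtains Z1 \<phi> t Z2 where "inversion_form g Z1 \<phi> t Z2"
  using assms(1)
proof (cases rule: isometry_cases)
  case 1
  then have "scales_height g" using similarity_form_height[OF 1] unfolding scales_height_def by blast
  then show ?thesis using assms(2) by simp
qed (rule that)

text \<open>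
  The parameter is determined by the heights alone: for \<open>x = s e\<close> the height formula exhibits
  \<open>t (s\<^sup>2 + |Z2|\<^sup>2)\<close> as a function of \<open>g\<close> and \<open>s\<close>, and \<open>t\<close> is its leading coefficient in \<open>s\<^sup>2\<close>.
\<close>

lemma A_param_inversion_form:
  assumes g: "inversion_form g Z1 \<phi> t Z2"
  shows "A_param e g = t"
  unfolding A_param_def
proof (rule the_equality)
  show "t > 0 \<and> (\<exists>Z1\<in>C_prime e. \<exists>\<phi>\<in>M_maps e. \<exists>Z2\<in>C_prime e. \<forall>\<zeta>\<in>D_space e.
        g \<zeta> = (n_map Z1 \<circ> C_inverse e \<circ> \<phi> \<circ> a_map t \<circ> n_map Z2) \<zeta>)"
    using g unfolding inversion_form_def by blast
next
  fix u assume "u > 0 \<and> (\<exists>Z1\<in>C_prime e. \<exists>\<phi>\<in>M_maps e. \<exists>Z2\<in>C_prime e. \<forall>\<zeta>\<in>D_space e.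
        g \<zeta> = (n_map Z1 \<circ> C_inverse e \<circ> \<phi> \<circ> a_map u \<circ> n_map Z2) \<zeta>)"
  then obtain W1 \<psi> W2 where g': "inversion_form g W1 \<psi> u W2"
    unfolding inversion_form_def by blast
  have C: "Z2 \<in> C_prime e" "W2 \<in> C_prime e" and pos: "t > 0" "u > 0"
    using g g' by (auto simp: inversion_form_def)
  have eq: "t * (s\<^sup>2 + (norm Z2)\<^sup>2) = u * (s\<^sup>2 + (norm W2)\<^sup>2)" if s: "s > 0" for s
  proof -
    have "s / (t * (s\<^sup>2 + (norm Z2)\<^sup>2)) = s / (u * (s\<^sup>2 + (norm W2)\<^sup>2))"
      using inversion_form_height[OF g multiple_of_e_in_D[OF s]]
        inversion_form_height[OF g' multiple_of_e_in_D[OF s]]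
      unfolding norm_add_C_prime[OF C(1)] norm_add_C_prime[OF C(2)] by (simp add: ht_def)
    moreover have "s\<^sup>2 + (norm Z2)\<^sup>2 \<noteq> 0" "s\<^sup>2 + (norm W2)\<^sup>2 \<noteq> 0"
      using s by (simp_all add: add_pos_nonneg less_imp_neq[symmetric])
    ultimately show ?thesis using s pos by (simp add: divide_eq_eq eq_divide_eq)
  qed
  show "u = t" using eq[of 1] eq[of 2] by (simp add: algebra_simps)
qed

lemma isometry_inv:
  assumes "g \<in> D_isometries e"
  shows "ginv g \<in> D_isometries e"
    "\<And>x. x \<in> D_space e \<Longrightarrow> g (ginv g x) = x"
    "\<And>x. x \<in> D_space e \<Longrightarrow> ginv g (g x) = x"
  using isometry_bij[OF assms] isometry_inverse[OF assms] unfolding inv_G_group[OF assms]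
  by (simp_all add: bij_betw_inv_into_right bij_betw_inv_into_left bij_betw_apply)

lemma isometry_D: "g \<in> D_isometries e \<Longrightarrow> x \<in> D_space e \<Longrightarrow> g x \<in> D_space e"
  using isometry_bij by (rule bij_betw_apply)

lemma ht_pos: "x \<in> D_space e \<Longrightarrow> ht e x > 0"
  by (simp add: ht_def D_space_def)

lemma scales_height_inv:
  assumes g: "g \<in> D_isometries e" and s: "scales_height (ginv g)"
  shows "scales_height g"
proof -
  obtain \<kappa> where k: "\<And>x. x \<in> D_space e \<Longrightarrow> ht e (ginv g x) = \<kappa> * ht e x"
    using s by (auto simp: scales_height_def)
  have "ht e (g x) = (1 / \<kappa>) * ht e x" if x: "x \<in> D_space e" for x
  proof -
    have "ht e x = \<kappa> * ht e (g x)"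
      using k[OF isometry_D[OF g x]] isometry_inv(3)[OF g x] by simp
    then show ?thesis using ht_pos[OF x] by (cases "\<kappa> = 0") auto
  qed
  then show ?thesis unfolding scales_height_def by blast
qed

text \<open>
  The inverse of \<open>g\<close> also has a normal form \<open>n\<^bsub>W1\<^esub> \<sigma> \<psi> a\<^bsub>u\<^esub> n\<^bsub>W2\<^esub>\<close>, and its value at \<open>\<infinity>\<close> is \<open>W1\<close>. To
  compare \<open>W1\<close> with \<open>- Z2\<close>, evaluate the heights in \<open>g (g\<^sup>-\<^sup>1 y) = y\<close> at \<open>y = s e - W2\<close>; the result
  is \<open>1 / (u s)\<^sup>2 + |W1 + Z2|\<^sup>2 = 1 / (t u s\<^sup>2)\<close>, and \<open>s = 1\<close>, \<open>s = 2\<close> give \<open>W1 + Z2 = 0\<close>.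
\<close>

lemma iso_center_inversion_form:
  assumes gI: "g \<in> D_isometries e" and g: "inversion_form g Z1 \<phi> t Z2"
  shows "iso_center e g = - Z2"
proof -
  let ?k = "ginv g"
  have kI: "?k \<in> D_isometries e" using gI by (rule isometry_inv)
  have "\<not> scales_height ?k"
    using scales_height_inv[OF gI] inversion_form_not_scales_height[OF g] by blast
  then obtain W1 \<psi> u W2 where k: "inversion_form ?k W1 \<psi> u W2"
    using isometry_inversion_form[OF kI] by blast
  have C: "Z2 \<in> C_prime e" "W1 \<in> C_prime e" "W2 \<in> C_prime e" "\<psi> \<in> M_maps e" and pos: "t > 0" "u > 0"
    using g k by (auto simp: inversion_form_def)
  define W where "W = W1 + Z2"
  have W: "W \<in> C_prime e" using C by (simp add: W_def C_prime_iff)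
  have Ce: "C_inverse e e = e" by (simp add: C_inverse_def conj_map_eq norm_e scaleR_2)
  have eq: "(1 / (u * s))\<^sup>2 + (norm W)\<^sup>2 = 1 / (t * u * s\<^sup>2)" if s: "s > 0" for s
  proof -
    define y where "y = s *\<^sub>R e - W2"
    have y: "y \<in> D_space e" using s C by (simp add: y_def D_space_def C_prime_iff)
    have "\<psi> (s *\<^sub>R e) = s *\<^sub>R e"
      using C(4) M_maps_linear[OF C(4)] by (simp add: linear_scale M_maps_def)
    then have ky: "?k y = W1 + (1 / (u * s)) *\<^sub>R e"
      using inversion_form_eq[OF k y] C_inverse_scaleR[of "u * s" e] by (simp add: y_def Ce)
    have kyD: "?k y \<in> D_space e" using kI y by (rule isometry_D)
    have "s = ht e (g (?k y))"
      using isometry_inv(2)[OF gI y] C by (simp add: y_def ht_def C_prime_iff)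
    also have "\<dots> = ht e (?k y) / (t * (norm (?k y + Z2))\<^sup>2)"
      using g kyD by (rule inversion_form_height)
    also have "?k y + Z2 = (1 / (u * s)) *\<^sub>R e + W" by (simp add: ky W_def)
    also have "ht e (?k y) = 1 / (u * s)" using C by (simp add: ky ht_def C_prime_iff)
    finally have "s = 1 / (u * s) / (t * ((1 / (u * s))\<^sup>2 + (norm W)\<^sup>2))"
      by (simp only: norm_add_C_prime[OF W])
    moreover have "(1 / (u * s))\<^sup>2 + (norm W)\<^sup>2 > 0"
      using s pos by (simp add: add_pos_nonneg)
    moreover have "N = 1 / (t * u * s\<^sup>2)" if "s = 1 / (u * s) / (t * N)" "N > 0" for N
    proof -
      have "s * (t * N) = 1 / (u * s)" using that pos s by (metis divide_eq_eq mult_pos_pos less_irrefl nonzero_eq_divide_eq)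
      then have "s * (t * N) * (u * s) = 1" using pos s by (simp add: eq_divide_eq)
      then have "N * (t * u * s\<^sup>2) = 1" by (simp only: power2_eq_square mult_ac)
      then show ?thesis using pos s by (simp add: eq_divide_eq)
    qed
    ultimately show ?thesis by blast
  qed
  have "(1 / u)\<^sup>2 + (norm W)\<^sup>2 = 1 / (t * u)"
    using eq[of 1] by simp
  moreover have "(1 / u)\<^sup>2 / 4 + (norm W)\<^sup>2 = 1 / (t * u) / 4"
    using eq[of 2] by (simp add: power_divide power_mult_distrib mult_ac)
  moreover have "N = 0" if "a + N = b" "a / 4 + N = b / 4" for a b N :: real
    using that by linarith
  ultimately have "(norm W)\<^sup>2 = 0" by blast
  then have "W1 = - Z2" by (simp add: W_def eq_neg_iff_add_eq_0)
  then show ?thesis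
    by (simp add: iso_center_def bdry_ext_inversion_form[OF k])
qed

text \<open>
  Here \<open>c = g\<^sup>-\<^sup>1\<infinity>\<close> and \<open>r = R(g)\<^sup>2 = t\<^sup>-\<^sup>1\<^sup>/\<^sup>2\<close>. Since the Cygan metric is the square root of the
  Euclidean distance when one point lies on the boundary, the Cygan radius \<open>R(g)\<close> corresponds to the
  Euclidean radius \<open>r\<close>.
\<close>

lemma isometric_sphere:
  assumes g: "g \<in> D_isometries e" and ninf: "g \<notin> G_inf e"
  obtains c r where "c \<in> C_prime e" "r > 0" "Ext_I e g = {z \<in> D_space e. norm (z - c) > r}"
    "\<And>z. z \<in> D_space e \<Longrightarrow> ht e (g z) = r\<^sup>2 * ht e z / (norm (z - c))\<^sup>2"
proof -
  obtain Z1 \<phi> t Z2 where f: "inversion_form g Z1 \<phi> t Z2"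
    using isometry_inversion_form[OF g] ninf G_inf_iff_scales_height[OF g] by blast
  have t: "t > 0" and Z2: "Z2 \<in> C_prime e" using f by (auto simp: inversion_form_def)
  define r where "r = t powr (- 1 / 2)"
  have r: "r > 0" using t by (simp add: r_def)
  have "r\<^sup>2 = t powr (- 1 / 2 + - 1 / 2)" unfolding r_def powr_add power2_eq_square ..
  then have r2: "r\<^sup>2 = 1 / t" using t by (simp add: powr_minus_divide)
  have "sqrt r = r powr (1 / 2)" using r by (simp add: powr_half_sqrt)
  also have "\<dots> = R_radius e g"
    by (simp add: r_def powr_powr R_radius_def A_param_inversion_form[OF f])
  finally have R: "R_radius e g = sqrt r" by simp
  have cyg: "cygan e z (- Z2) = sqrt (norm (z - (- Z2)))" if "z \<in> D_space e" for z
  proof -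
    have "\<bar>Re_part e z - Re_part e (- Z2)\<bar> *\<^sub>R e + Im_part e z - Im_part e (- Z2) = z - (- Z2)"
      using that Z2 by (simp add: C_prime_iff D_space_def Im_part_def)
    then show ?thesis by (simp only: cygan_def)
  qed
  show thesis
  proof
    show "- Z2 \<in> C_prime e" using Z2 by (simp add: C_prime_iff)
    show "Ext_I e g = {z \<in> D_space e. norm (z - (- Z2)) > r}"
      unfolding Ext_I_def iso_center_inversion_form[OF g f] R
      using cyg real_sqrt_less_iff by auto
    show "ht e (g z) = r\<^sup>2 * ht e z / (norm (z - (- Z2)))\<^sup>2" if "z \<in> D_space e" for z
      using inversion_form_height[OF f that] by (simp add: r2)
  qed (rule r)
qed

lemma Ext_I_convex:
  assumes "g \<in> D_isometries e" "g \<notin> G_inf e"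
  shows "geodesically_convex e (Ext_I e g)"
  using isometric_sphere[OF assms] half_ball_exterior_convex by metis

lemma norm_diff_C_prime_pos:
  assumes "c \<in> C_prime e" "z \<in> D_space e"
  shows "norm (z - c) > 0"
  using assms by (auto simp: C_prime_iff D_space_def)

lemma Ext_I_iff_height_decreases:
  assumes "g \<in> D_isometries e" "g \<notin> G_inf e" and z: "z \<in> D_space e"
  shows "z \<in> Ext_I e g \<longleftrightarrow> ht e (g z) < ht e z"
proof -
  obtain c r where c: "c \<in> C_prime e" "r > 0" "Ext_I e g = {z \<in> D_space e. norm (z - c) > r}"
    "\<And>z. z \<in> D_space e \<Longrightarrow> ht e (g z) = r\<^sup>2 * ht e z / (norm (z - c))\<^sup>2"
    using isometric_sphere[OF assms(1,2)] by blast
  have n: "norm (z - c) > 0" using norm_diff_C_prime_pos c(1) z .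
  then have "ht e (g z) < ht e z \<longleftrightarrow> r\<^sup>2 < (norm (z - c))\<^sup>2"
    using ht_pos[OF z] by (simp add: c(4)[OF z] divide_less_eq mult.commute)
  also have "\<dots> \<longleftrightarrow> r < norm (z - c)"
    using c(2) by (simp add: power_mono_iff flip: linorder_not_le)
  finally show ?thesis using z by (simp add: c(3))
qed

lemma D_cl_eq: "D_cl e Y = D_space e \<inter> closure (D_space e \<inter> Y)"
  by (simp add: closure_of_subtopology)

text \<open>
  Moving a point of \<open>D\<close> vertically upwards strictly increases its distance to a boundary point, so
  a point on the isometric sphere is approached from the exterior along its vertical line.
\<close>

lemma closure_Ext_I:
  assumes "g \<in> D_isometries e" "g \<notin> G_inf e" and z: "z \<in> D_space e" and le: "ht e (g z) \<le> ht e z"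
  shows "z \<in> D_cl e (Ext_I e g)"
proof -
  obtain c r where c: "c \<in> C_prime e" "r > 0" "Ext_I e g = {z \<in> D_space e. norm (z - c) > r}"
    "\<And>z. z \<in> D_space e \<Longrightarrow> ht e (g z) = r\<^sup>2 * ht e z / (norm (z - c))\<^sup>2"
    using isometric_sphere[OF assms(1,2)] by blast
  have n: "norm (z - c) > 0" using norm_diff_C_prime_pos c(1) z .
  then have rn: "r\<^sup>2 \<le> (norm (z - c))\<^sup>2"
    using ht_pos[OF z] le by (simp add: c(4)[OF z] divide_le_eq mult.commute)
  have k: "Re_part e (z - c) > 0" using z c(1) by (simp add: D_space_def C_prime_iff)
  have Ext: "z + s *\<^sub>R e \<in> Ext_I e g" if s: "s > 0" for s
  proof -
    have "(norm (z + s *\<^sub>R e - c))\<^sup>2 = (norm (z - c))\<^sup>2 + 2 * s * Re_part e (z - c) + s\<^sup>2"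
      using norm_scaled_diff_square[of 1 "z - c" "- s" e] norm_e
      by (simp add: Re_part_def algebra_simps)
    also have "\<dots> > r\<^sup>2"
    proof -
      have "2 * s * Re_part e (z - c) > 0" "s\<^sup>2 > 0" using s k by (simp_all del: Re_part_simps)
      then show ?thesis using rn by linarith
    qed
    finally have "r < norm (z + s *\<^sub>R e - c)" by (rule power2_less_imp_less) simp
    then show ?thesis using s z by (simp add: c(3) D_space_def)
  qed
  have "z \<in> closure (D_space e \<inter> Ext_I e g)"
    unfolding closure_approachable
  proof (intro allI impI)
    fix \<epsilon> :: real assume \<epsilon>: "\<epsilon> > 0"
    have "dist (z + (\<epsilon> / 2) *\<^sub>R e) z < \<epsilon>" using \<epsilon> norm_e by (simp add: dist_norm)
    then show "\<exists>y\<in>D_space e \<inter> Ext_I e g. dist y z < \<epsilon>"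
      using Ext[of "\<epsilon> / 2"] \<epsilon> by (auto simp: c(3))
  qed
  then show ?thesis using z by (simp add: D_cl_eq)
qed

end

section \<open>Fundamental domains\<close>

lemma mult_G_group:
  assumes "g \<in> D_isometries e" "h \<in> D_isometries e" "x \<in> D_space e"
  shows "(g \<otimes>\<^bsub>G_group e\<^esub> h) x = g (h x)"
  using assms by (simp add: G_group_def BijGroup_def D_isometries_def compose_def)

lemma one_G_group: "\<one>\<^bsub>G_group e\<^esub> = (\<lambda>x\<in>D_space e. x)"
  by (simp add: G_group_def BijGroup_def)

locale isometry_subgroup = half_space e for e :: "'a::euclidean_space" +
  fixes \<Gamma> :: "('a \<Rightarrow> 'a) set"
  assumes subgroup: "subgroup \<Gamma> (G_group e)"
begin

abbreviation \<Gamma>_inf where "\<Gamma>_inf \<equiv> stab_inf e \<Gamma>"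
abbreviation G where "G \<equiv> G_group e"

lemma isometry: "g \<in> \<Gamma> \<Longrightarrow> g \<in> D_isometries e"
  using subgroup.subset[OF subgroup] by (auto simp: G_group_def)

lemma mult_closed: "g \<in> \<Gamma> \<Longrightarrow> h \<in> \<Gamma> \<Longrightarrow> g \<otimes>\<^bsub>G\<^esub> h \<in> \<Gamma>"
  by (rule subgroup.m_closed[OF subgroup])

lemma inv_closed: "g \<in> \<Gamma> \<Longrightarrow> ginv g \<in> \<Gamma>"
  by (rule subgroup.m_inv_closed[OF subgroup])

lemma mult_apply: "g \<in> \<Gamma> \<Longrightarrow> h \<in> \<Gamma> \<Longrightarrow> x \<in> D_space e \<Longrightarrow> (g \<otimes>\<^bsub>G\<^esub> h) x = g (h x)"
  using mult_G_group isometry by blast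

lemma equal_if_agree:
  assumes "g \<in> \<Gamma>" "h \<in> \<Gamma>" "\<And>x. x \<in> D_space e \<Longrightarrow> g x = h x"
  shows "g = h"
  using assms isometry by (intro extensionalityI[of g "D_space e" h]) (auto simp: D_isometries_def Bij_def)

lemma stab_inf_iff: "g \<in> \<Gamma> \<Longrightarrow> g \<in> \<Gamma>_inf \<longleftrightarrow> scales_height g"
  using G_inf_iff_scales_height[OF isometry] by (simp add: stab_inf_def)

lemma not_stab_inf:
  assumes "g \<in> \<Gamma> - \<Gamma>_inf"
  shows "g \<in> \<Gamma>" "g \<in> D_isometries e" "g \<notin> G_inf e"
  using assms isometry by (auto simp: stab_inf_def)

lemma inv_not_stab_inf:
  assumes "g \<in> \<Gamma> - \<Gamma>_inf"
  shows "ginv g \<in> \<Gamma> - \<Gamma>_inf"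
  using assms scales_height_inv[OF isometry] inv_closed stab_inf_iff by blast

lemma inv_stab_inf:
  assumes "g \<in> \<Gamma>_inf"
  shows "ginv g \<in> \<Gamma>_inf"
proof -
  have g: "g \<in> \<Gamma>" using assms by (simp add: stab_inf_def)
  have "ginv (ginv g) = g"
  proof (rule equal_if_agree)
    fix x assume x: "x \<in> D_space e"
    have "ginv (ginv g) (ginv g (g x)) = g x"
      using isometry_inv(3)[OF isometry[OF inv_closed[OF g]] isometry_D[OF isometry[OF g] x]] .
    then show "ginv (ginv g) x = g x" using isometry_inv(3)[OF isometry[OF g] x] by simp
  qed (use g inv_closed in auto)
  then show ?thesis
    using scales_height_inv[OF isometry[OF inv_closed[OF g]]] assms g inv_closed stab_inf_iff by metis
qed

text \<open>
  If \<open>g\<close> and \<open>g h\<close> both scale heights by constants, then so does \<open>h\<close>.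
\<close>

lemma mult_not_stab_inf:
  assumes g: "g \<in> \<Gamma>_inf" and h: "h \<in> \<Gamma> - \<Gamma>_inf"
  shows "g \<otimes>\<^bsub>G\<^esub> h \<in> \<Gamma> - \<Gamma>_inf"
proof -
  have g\<Gamma>: "g \<in> \<Gamma>" and h\<Gamma>: "h \<in> \<Gamma>" using g h by (auto simp: stab_inf_def)
  obtain \<kappa> where k: "\<And>x. x \<in> D_space e \<Longrightarrow> ht e (g x) = \<kappa> * ht e x"
    using g stab_inf_iff[OF g\<Gamma>] by (auto simp: scales_height_def)
  have "scales_height h" if gh: "scales_height (g \<otimes>\<^bsub>G\<^esub> h)"
  proof -
    obtain \<mu> where m: "\<And>x. x \<in> D_space e \<Longrightarrow> ht e ((g \<otimes>\<^bsub>G\<^esub> h) x) = \<mu> * ht e x"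
      using gh by (auto simp: scales_height_def)
    have "ht e (h x) = (\<mu> / \<kappa>) * ht e x" if x: "x \<in> D_space e" for x
    proof -
      have hx: "h x \<in> D_space e" using isometry[OF h\<Gamma>] x by (rule isometry_D)
      have "\<kappa> * ht e (h x) = \<mu> * ht e x"
        using k[OF hx] m[OF x] mult_apply[OF g\<Gamma> h\<Gamma> x] by simp
      moreover have "\<kappa> \<noteq> 0"
        using k[OF hx] ht_pos[OF isometry_D[OF isometry[OF g\<Gamma>] hx]] by auto
      ultimately show ?thesis by (simp add: field_simps)
    qed
    then show ?thesis unfolding scales_height_def by blast
  qed
  then show ?thesis using mult_closed[OF g\<Gamma> h\<Gamma>] h stab_inf_iff by blast
qed

text \<open>
  An element \<open>g\<close> of \<open>\<Gamma>\<^sub>\<infinity>\<close> is the product \<open>(g h) h\<^sup>-\<^sup>1\<close> for any \<open>h\<close> moving \<open>\<infinity>\<close>, and \<open>g h\<close> moves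
  \<open>\<infinity>\<close> too.
\<close>

lemma generate_not_stab_inf:
  assumes "\<Gamma> - \<Gamma>_inf \<noteq> {}"
  shows "generate G (\<Gamma> - \<Gamma>_inf) = \<Gamma>"
proof
  show "generate G (\<Gamma> - \<Gamma>_inf) \<subseteq> \<Gamma>"
  proof
    fix g assume "g \<in> generate G (\<Gamma> - \<Gamma>_inf)"
    then show "g \<in> \<Gamma>"
      by induction (auto intro: mult_closed inv_closed subgroup.one_closed[OF subgroup])
  qed
  show "\<Gamma> \<subseteq> generate G (\<Gamma> - \<Gamma>_inf)"
  proof
    fix g assume g: "g \<in> \<Gamma>"
    obtain h where h: "h \<in> \<Gamma> - \<Gamma>_inf" using assms by blast
    show "g \<in> generate G (\<Gamma> - \<Gamma>_inf)"
    proof (cases "g \<in> \<Gamma>_inf")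
      case True
      have gh: "g \<otimes>\<^bsub>G\<^esub> h \<in> \<Gamma> - \<Gamma>_inf" using True h by (rule mult_not_stab_inf)
      have "(g \<otimes>\<^bsub>G\<^esub> h) \<otimes>\<^bsub>G\<^esub> ginv h = g"
      proof (rule equal_if_agree)
        fix x assume x: "x \<in> D_space e"
        have hI: "h \<in> D_isometries e" "ginv h x \<in> D_space e"
          using h isometry isometry_inv(1) isometry_D x by auto
        show "((g \<otimes>\<^bsub>G\<^esub> h) \<otimes>\<^bsub>G\<^esub> ginv h) x = g x"
          using g h x hI inv_closed mult_closed by (simp add: mult_apply isometry_inv(2))
      qed (use g h inv_closed mult_closed in auto)
      moreover have "g \<otimes>\<^bsub>G\<^esub> h \<in> generate G (\<Gamma> - \<Gamma>_inf)" using gh by (rule generate.incl)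
      moreover have "ginv h \<in> generate G (\<Gamma> - \<Gamma>_inf)" using h by (rule generate.inv)
      ultimately show ?thesis using generate.eng by metis
    next
      case False
      then show ?thesis using g by (auto intro: generate.incl)
    qed
  qed
qed

lemma maximal_height:
  assumes "\<Gamma> - \<Gamma>_inf \<noteq> {}" "type_F e (\<Gamma> - \<Gamma>_inf)" "z \<in> D_space e"
  obtains h where "h \<in> \<Gamma>" "\<And>g. g \<in> \<Gamma> \<Longrightarrow> ht e (g z) \<le> ht e (h z)"
  using assms(2,3) unfolding type_F_def generate_not_stab_inf[OF assms(1)] by blast

text \<open>
  If an element of \<open>\<Gamma>\<^sub>\<infinity>\<close> scaled heights by more than \<open>1\<close>, it would raise the highest point of
  every orbit. The same applies to its inverse.
\<close>

lemma stab_inf_preserves_height: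
  assumes ne: "\<Gamma> - \<Gamma>_inf \<noteq> {}" and F: "type_F e (\<Gamma> - \<Gamma>_inf)" and g: "g \<in> \<Gamma>_inf" and x: "x \<in> D_space e"
  shows "ht e (g x) = ht e x"
proof -
  have le: "ht e (g x) \<le> ht e x" if g: "g \<in> \<Gamma>_inf" and x: "x \<in> D_space e" for g x
  proof -
    have g\<Gamma>: "g \<in> \<Gamma>" using g by (simp add: stab_inf_def)
    obtain \<kappa> where k: "\<And>x. x \<in> D_space e \<Longrightarrow> ht e (g x) = \<kappa> * ht e x"
      using g stab_inf_iff[OF g\<Gamma>] by (auto simp: scales_height_def)
    obtain h where h: "h \<in> \<Gamma>" "\<And>g. g \<in> \<Gamma> \<Longrightarrow> ht e (g x) \<le> ht e (h x)"
      using maximal_height[OF ne F x] by blast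
    have hx: "h x \<in> D_space e" using isometry[OF h(1)] x by (rule isometry_D)
    have "\<kappa> * ht e (h x) \<le> ht e (h x)"
      using h(2)[OF mult_closed[OF g\<Gamma> h(1)]] mult_apply[OF g\<Gamma> h(1) x] k[OF hx] by simp
    then have "\<kappa> \<le> 1" using ht_pos[OF hx] by simp
    then show ?thesis using k[OF x] ht_pos[OF x] by simp
  qed
  have g\<Gamma>: "g \<in> \<Gamma>" using g by (simp add: stab_inf_def)
  have gx: "g x \<in> D_space e" using isometry[OF g\<Gamma>] x by (rule isometry_D)
  have "ht e x \<le> ht e (g x)"
    using le[OF inv_stab_inf[OF g] gx] isometry_inv(3)[OF isometry[OF g\<Gamma>] x] by simp
  then show ?thesis using le[OF g x] by simp
qed

text \<open>
  The argument with highest points of orbits applies when some element of \<open>\<Gamma>\<close> moves \<open>\<infinity>\<close>, since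
  only then does \<open>\<Gamma> - \<Gamma>_inf\<close> generate \<open>\<Gamma>\<close>. Otherwise the index set of the intersection is empty,
  and the domain in question is \<open>F_inf\<close> itself.
\<close>

lemma Ford_domain:
  assumes O: "type_O e \<Gamma>"
    and F: "type_F e (\<Gamma> - \<Gamma>_inf)"
    and convex: "geodesically_convex e F_inf"
    and dom: "fundamental_domain e \<Gamma>_inf F_inf"
    and closures: "D_cl e F_inf \<inter> (\<Inter>g\<in>\<Gamma> - \<Gamma>_inf. D_cl e (Ext_I e g))
           = D_cl e (F_inf \<inter> (\<Inter>g\<in>\<Gamma> - \<Gamma>_inf. Ext_I e g))"
  shows "geodesically_convex e (F_inf \<inter> (\<Inter>g\<in>\<Gamma> - \<Gamma>_inf. Ext_I e g))
       \<and> fundamental_domain e \<Gamma> (F_inf \<inter> (\<Inter>g\<in>\<Gamma> - \<Gamma>_inf. Ext_I e g))"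
proof (cases "\<Gamma> - \<Gamma>_inf = {}")
  case True
  then have "\<Gamma>_inf = \<Gamma>" by (auto simp: stab_inf_def)
  then show ?thesis using convex dom by simp
next
  case ne: False
  define Y where "Y = F_inf \<inter> (\<Inter>g\<in>\<Gamma> - \<Gamma>_inf. Ext_I e g)"
  have F_inf: "open F_inf" "F_inf \<subseteq> D_space e" "D_space e = (\<Union>g\<in>\<Gamma>_inf. g ` D_cl e F_inf)"
    and disj: "\<And>g h. g \<in> \<Gamma>_inf \<Longrightarrow> h \<in> \<Gamma>_inf \<Longrightarrow> g \<noteq> h \<Longrightarrow> g ` F_inf \<inter> h ` F_inf = {}"
    using dom[unfolded fundamental_domain_def fundamental_region_def] by simp_all
  have YD: "Y \<subseteq> D_space e" using F_inf(2) by (auto simp: Y_def)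
  have Y_convex: "geodesically_convex e Y"
    unfolding geodesically_convex_def
  proof (intro ballI allI impI)
    fix x y \<gamma> l assume xy: "x \<in> Y" "y \<in> Y" and seg: "geodesic_segment e \<gamma> l x y"
    have sub: "\<gamma> ` {0..l} \<subseteq> W" if "geodesically_convex e W" "x \<in> W" "y \<in> W" for W
      using that(1)[unfolded geodesically_convex_def, rule_format, OF that(2,3) seg] .
    have "\<gamma> ` {0..l} \<subseteq> F_inf"
      using xy by (intro sub convex) (auto simp: Y_def)
    moreover have "\<gamma> ` {0..l} \<subseteq> Ext_I e g" if g: "g \<in> \<Gamma> - \<Gamma>_inf" for g
      using xy g by (intro sub Ext_I_convex[OF not_stab_inf(2,3)[OF g]]) (auto simp: Y_def)
    ultimately show "\<gamma> ` {0..l} \<subseteq> Y" unfolding Y_def by blast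
  qed
  have "open Y"
  proof -
    let ?I = "\<Union>g\<in>\<Gamma> - \<Gamma>_inf. Int_I e g"
    have "Y = F_inf \<inter> (D_space e \<inter> (\<Inter>g\<in>\<Gamma> - \<Gamma>_inf. Ext_I e g))"
      using F_inf(2) by (auto simp: Y_def)
    also have "\<dots> = F_inf \<inter> (D_space e - D_cl e ?I)"
      using O by (simp only: type_O_def)
    also have "\<dots> = F_inf \<inter> - closure (D_space e \<inter> ?I)"
      using F_inf(2) unfolding D_cl_eq by blast
    finally have "Y = F_inf \<inter> - closure (D_space e \<inter> ?I)" .
    then show ?thesis using F_inf(1) by (simp add: open_Int open_Compl)
  qed
  moreover have "g ` Y \<inter> h ` Y = {}" if g: "g \<in> \<Gamma>" and h: "h \<in> \<Gamma>" and gh: "g \<noteq> h" for g h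
  proof (rule ccontr)
    assume "g ` Y \<inter> h ` Y \<noteq> {}"
    then obtain x y where xy: "x \<in> Y" "y \<in> Y" "g x = h y" by blast
    then have xyD: "x \<in> D_space e" "y \<in> D_space e" using YD by auto
    let ?k = "ginv h \<otimes>\<^bsub>G\<^esub> g"
    have k: "?k \<in> \<Gamma>" using g h by (intro mult_closed inv_closed)
    have kz: "?k z = ginv h (g z)" if "z \<in> D_space e" for z
      using g h that by (intro mult_apply inv_closed)
    have kx: "?k x = y" using kz[OF xyD(1)] xy(3) isometry_inv(3)[OF isometry[OF h] xyD(2)] by simp
    show False
    proof (cases "?k \<in> \<Gamma>_inf")
      case True
      have one: "\<one>\<^bsub>G\<^esub> \<in> \<Gamma>" by (rule subgroup.one_closed[OF subgroup])
      have one_id: "\<one>\<^bsub>G\<^esub> z = z" if "z \<in> D_space e" for z using that by (simp add: one_G_group)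
      have "scales_height (\<one>\<^bsub>G\<^esub>)"
        unfolding scales_height_def by (rule exI[of _ 1]) (simp add: one_id)
      then have "\<one>\<^bsub>G\<^esub> \<in> \<Gamma>_inf" using stab_inf_iff[OF one] by simp
      moreover have "?k \<noteq> \<one>\<^bsub>G\<^esub>"
      proof
        assume k1: "?k = \<one>\<^bsub>G\<^esub>"
        have "g z = h z" if z: "z \<in> D_space e" for z
        proof -
          have "ginv h (g z) = z" using kz[OF z] one_id[OF z] k1 by simp
          then show ?thesis
            using isometry_inv(2)[OF isometry[OF h] isometry_D[OF isometry[OF g] z]] by simp
        qed
        then show False using equal_if_agree[OF g h] gh by blast
      qed
      ultimately have "?k ` F_inf \<inter> \<one>\<^bsub>G\<^esub> ` F_inf = {}" using disj[OF True] by blast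
      moreover have "y \<in> ?k ` F_inf" using xy(1) kx by (auto simp: Y_def)
      moreover have "y \<in> \<one>\<^bsub>G\<^esub> ` F_inf" using xy(2) one_id[OF xyD(2)] by (force simp: Y_def)
      ultimately show False by blast
    next
      case False
      then have kT: "?k \<in> \<Gamma> - \<Gamma>_inf" using k by simp
      have ext: "ht e (g z) < ht e z" if "g \<in> \<Gamma> - \<Gamma>_inf" "z \<in> Y" for g z
        using Ext_I_iff_height_decreases[OF not_stab_inf(2,3)[OF that(1)]] that YD by (auto simp: Y_def)
      have "ht e y < ht e x" using ext[OF kT xy(1)] kx by simp
      moreover have "ht e x < ht e y"
        using ext[OF inv_not_stab_inf[OF kT] xy(2)] isometry_inv(3)[OF isometry[OF k] xyD(1)] kx by simp
      ultimately show False by simp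
    qed
  qed
  moreover have "D_space e = (\<Union>g\<in>\<Gamma>. g ` D_cl e Y)"
  proof
    show "(\<Union>g\<in>\<Gamma>. g ` D_cl e Y) \<subseteq> D_space e"
      using isometry isometry_D unfolding D_cl_eq by blast
    show "D_space e \<subseteq> (\<Union>g\<in>\<Gamma>. g ` D_cl e Y)"
    proof
      fix z assume z: "z \<in> D_space e"
      obtain h where h: "h \<in> \<Gamma>" "\<And>g. g \<in> \<Gamma> \<Longrightarrow> ht e (g z) \<le> ht e (h z)"
        using maximal_height[OF ne F z] by blast
      have hz: "h z \<in> D_space e" using isometry[OF h(1)] z by (rule isometry_D)
      then obtain k v where k: "k \<in> \<Gamma>_inf" and v: "v \<in> D_cl e F_inf" "h z = k v"
        using F_inf(3) by blast
      have k\<Gamma>: "k \<in> \<Gamma>" using k by (simp add: stab_inf_def)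
      have vD: "v \<in> D_space e" using v(1) by (simp add: D_cl_eq)
      have vh: "v = ginv k (h z)" using isometry_inv(3)[OF isometry[OF k\<Gamma>] vD] v(2) by simp
      have htv: "ht e v = ht e (h z)" using stab_inf_preserves_height[OF ne F k vD] v(2) by simp
      let ?m = "ginv k \<otimes>\<^bsub>G\<^esub> h"
      have m: "?m \<in> \<Gamma>" "?m z = v"
        using k\<Gamma> h(1) vh mult_apply[OF inv_closed[OF k\<Gamma>] h(1) z] by (auto intro: mult_closed inv_closed)
      have "v \<in> D_cl e (Ext_I e g)" if g: "g \<in> \<Gamma> - \<Gamma>_inf" for g
      proof (rule closure_Ext_I[OF not_stab_inf(2,3)[OF g] vD])
        have "g \<otimes>\<^bsub>G\<^esub> ?m \<in> \<Gamma>" "(g \<otimes>\<^bsub>G\<^esub> ?m) z = g v"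
          using g m mult_apply[OF _ m(1) z] mult_closed by auto
        then show "ht e (g v) \<le> ht e v" using h(2) htv by metis
      qed
      then have "v \<in> D_cl e Y" using v(1) closures unfolding Y_def by blast
      moreover have "z = ginv ?m v" using isometry_inv(3)[OF isometry[OF m(1)] z] m(2) by simp
      ultimately show "z \<in> (\<Union>g\<in>\<Gamma>. g ` D_cl e Y)" using inv_closed[OF m(1)] by blast
    qed
  qed
  ultimately have "fundamental_region e \<Gamma> Y"
    unfolding fundamental_region_def using YD by blast
  then show ?thesis
    using Y_convex geodesically_convex_imp_connected[OF Y_convex YD]
    unfolding fundamental_domain_def Y_def by blast
qed

end

theorem corollary3p23:
  fixes e :: "'a::euclidean_space"
    and \<Gamma> :: "('a \<Rightarrow> 'a) set"
    and F_inf :: "'a set"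
  assumes "norm e = 1"
    and "span {e} \<noteq> UNIV"
    and "subgroup \<Gamma> (G_group e)"
    and "type_O e \<Gamma>"
    and "type_F e (\<Gamma> - stab_inf e \<Gamma>)"
    and "geodesically_convex e F_inf"
    and "fundamental_domain e (stab_inf e \<Gamma>) F_inf"
    and "D_cl e F_inf \<inter> (\<Inter>g\<in>\<Gamma> - stab_inf e \<Gamma>. D_cl e (Ext_I e g))
           = D_cl e (F_inf \<inter> (\<Inter>g\<in>\<Gamma> - stab_inf e \<Gamma>. Ext_I e g))"
  shows "geodesically_convex e (F_inf \<inter> (\<Inter>g\<in>\<Gamma> - stab_inf e \<Gamma>. Ext_I e g))
       \<and> fundamental_domain e \<Gamma> (F_inf \<inter> (\<Inter>g\<in>\<Gamma> - stab_inf e \<Gamma>. Ext_I e g))"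
proof -
  interpret isometry_subgroup e \<Gamma>
    by (intro isometry_subgroup.intro half_space.intro isometry_subgroup_axioms.intro assms(1,3))
  show ?thesis using assms(4-8) by (rule Ford_domain)
qed

end
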